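(* For each integer $N\ge 2$, let $p=p(N)$ be the smallest prime such that $p-\left(\lceil\sqrt{p}\,\rceil+\lfloor p/\lceil\sqrt{p}\,\rceil\rfloor-1\right)\ge N$, and let $\{c(t),\ 0\le t\le 2p^2-1\}$ be the sequence produced by the general IDEAL-CH construction (described in the context). Then this sequence is an $(N,2p^2)$-MACH sequence, and the construction has asymptotic approximation ratio $2$, i.e. $$\lim_{N\to\infty}\frac{2\,p(N)^2}{N^2}=2 .$$
   Context: **MACH sequence.** A sequence $\{c(t),\ 0\le t\le q-1\}$ is an $(N,q)$-MACH sequence if for every time shift $0\le d\le q-1$ and every channel $0\le k\le N-1$ there exists $0\le t\le q-1$ such that $c(t)=c((t+d)\bmod q)=k$. The asymptotic approximation ratio of a family of such sequences is the limit, as $N\to\infty$, of the ratio of the period $q$ to the lower bound $N^2$. **Ideal matrix.** Let $\oplus$ denote addition modulo $p$; rows and columns are indexed by $0,\dots,p-1$. A $(0,1)$ matrix $M=(m_{i,j})$ of size $p\times p$ is ideal if (i) each column contains exactly one $1$; and (ii) $\rho(\delta,\tau)=\sum_{i=0}^{p-1}\sum_{j=0}^{p-1}m_{i\oplus\delta,j\oplus\tau}\,m_{i,j}$ satisfies $\rho(\delta,\tau)\le 1$ for all $0\le\delta,\tau\le p-1$ with $(\delta,\tau)\neq(0,0)$. (For $p$ prime such matrices are known to exist by the Elliott–Butson construction.) **General IDEAL-CH construction.** Input: $N$ channels $\{0,1,\dots,N-1\}$. 1. Find the smallest prime $p$ such that $p-(\lceil\sqrt p\,\rceil+\lfloor p/\lceil\sqrt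 p\,\rceil\rfloor-1)\ge N$ and construct a $p\times p$ ideal matrix $M=(m_{i,j})$ (any one). 2. Construct $\tilde M=(\tilde m_{i,j})$ by replacing, for each $j$, column $j$ of $M$ by the $(p-i)$-th rotation of $(0,1,\dots,p-1)$, where $i$ is the unique row with $m_{i,j}=1$; that is, $\tilde m_{i',j}=(i'+p-i)\bmod p$ for all $i'$. 3. Let $\Delta=\lceil\sqrt p\,\rceil$ and $D=\{0,1,\dots,\Delta-1\}\cup\{m\Delta-1: 2\le m\le\lfloor p/\Delta\rfloor\}$. 4. Let $D^c=\{0,\dots,p-1\}\setminus D=\{b_0,b_1,\dots,b_{p-1-|D|}\}$ (any enumeration). 5. Let $C=(c_{i,j})$ be the $p\times p$ matrix with $c_{i,j}=(j\bmod N)$ if $\tilde m_{i,j}\in D$, and $c_{i,j}=(\ell\bmod N)$ if $\tilde m_{i,j}=b_\ell$. 6. For $t=0,\dots,2p^2-1$, let $c(t)=c_{i,j}$ with $i=\lfloor t/(2p)\rfloor$ and $j=(t\bmod p)$. *)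

theory Defs
  imports Complex_Main "HOL-Computational_Algebra.Primes"
begin

definition is_MACH :: "nat \<Rightarrow> nat \<Rightarrow> (nat \<Rightarrow> nat) \<Rightarrow> bool" where
  "is_MACH N q c \<longleftrightarrow>
     (\<forall>d<q. \<forall>k<N. \<exists>t<q. c t = k \<and> c ((t + d) mod q) = k)"

text \<open>A \<open>p \<times> p\<close> matrix is a function of a row and a column index; only indices below \<open>p\<close> matter.\<close>

definition ideal_corr :: "nat \<Rightarrow> (nat \<Rightarrow> nat \<Rightarrow> nat) \<Rightarrow> nat \<Rightarrow> nat \<Rightarrow> nat" where
  "ideal_corr p M \<delta> \<tau> =
     (\<Sum>i<p. \<Sum>j<p. M ((i + \<delta>) mod p) ((j + \<tau>) mod p) * M i j)"

definition ideal_matrix :: "nat \<Rightarrow> (nat \<Rightarrow> nat \<Rightarrow> nat) \<Rightarrow> bool" where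
  "ideal_matrix p M \<longleftrightarrow>
     (\<forall>i<p. \<forall>j<p. M i j \<in> {0, 1}) \<and>
     (\<forall>j<p. \<exists>!i. i < p \<and> M i j = 1) \<and>
     (\<forall>\<delta><p. \<forall>\<tau><p. (\<delta>, \<tau>) \<noteq> (0, 0) \<longrightarrow> ideal_corr p M \<delta> \<tau> \<le> 1)"

definition ch_Delta :: "nat \<Rightarrow> nat" where
  "ch_Delta p = nat \<lceil>sqrt (real p)\<rceil>"

text \<open>The inequality is over the integers, since subtraction on \<^typ>\<open>nat\<close> truncates.\<close>

definition ch_prime :: "nat \<Rightarrow> nat" where
  "ch_prime N = (LEAST p. prime p \<and>
     int p - (int (ch_Delta p) + int (p div ch_Delta p) - 1) \<ge> int N)"

definition ch_D :: "nat \<Rightarrow> nat set" where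
  "ch_D p = {0..<ch_Delta p} \<union> {m * ch_Delta p - 1 | m. 2 \<le> m \<and> m \<le> p div ch_Delta p}"

definition ch_Dc :: "nat \<Rightarrow> nat set" where
  "ch_Dc p = {0..<p} - ch_D p"

definition one_row :: "nat \<Rightarrow> (nat \<Rightarrow> nat \<Rightarrow> nat) \<Rightarrow> nat \<Rightarrow> nat" where
  "one_row p M j = (THE i. i < p \<and> M i j = 1)"

definition ch_tilde :: "nat \<Rightarrow> (nat \<Rightarrow> nat \<Rightarrow> nat) \<Rightarrow> nat \<Rightarrow> nat \<Rightarrow> nat" where
  "ch_tilde p M i j = (i + p - one_row p M j) mod p"

text \<open>Below, \<open>b\<close> enumerates \<^term>\<open>ch_Dc p\<close>, so \<^const>\<open>inv_into\<close> yields the index \<open>\<ell>\<close> with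
  \<open>b \<ell>\<close> equal to the given entry.\<close>

definition ch_matrix ::
  "nat \<Rightarrow> nat \<Rightarrow> (nat \<Rightarrow> nat \<Rightarrow> nat) \<Rightarrow> (nat \<Rightarrow> nat) \<Rightarrow> nat \<Rightarrow> nat \<Rightarrow> nat" where
  "ch_matrix N p M b i j =
     (if ch_tilde p M i j \<in> ch_D p then j mod N
      else inv_into {0..<card (ch_Dc p)} b (ch_tilde p M i j) mod N)"

definition ideal_ch_seq ::
  "nat \<Rightarrow> nat \<Rightarrow> (nat \<Rightarrow> nat \<Rightarrow> nat) \<Rightarrow> (nat \<Rightarrow> nat) \<Rightarrow> nat \<Rightarrow> nat" where
  "ideal_ch_seq N p M b t = ch_matrix N p M b (t div (2 * p)) (t mod p)"

text \<open>The prime and the ideal matrix required by the construction always exist.\<close>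

lemma ch_prime_candidate:
  "\<exists>p. prime p \<and> int p - (int (ch_Delta p) + int (p div ch_Delta p) - 1) \<ge> int N"
proof -
  obtain p :: nat where p: "prime p" "p > (N + 2)\<^sup>2"
    using bigger_prime by blast
  define s where "s = sqrt (real p)"
  have ss: "s * s = real p" by (simp add: s_def)
  have sN: "s \<ge> real N + 2"
    unfolding s_def using p(2)
    by (intro real_le_rsqrt) (metis less_imp_le of_nat_add of_nat_le_iff of_nat_numeral of_nat_power)
  have D1: "s \<le> real (ch_Delta p)" and D2: "real (ch_Delta p) \<le> s + 1"
    unfolding ch_Delta_def s_def[symmetric] using sN by linarith+
  have "real (p div ch_Delta p) \<le> real p / real (ch_Delta p)"
    by (rule of_nat_div_le_of_nat)
  also have "\<dots> \<le> real p / s"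
    using D1 sN by (intro divide_left_mono mult_pos_pos) auto
  also have "\<dots> = s" using ss sN by (simp add: field_simps)
  finally have D3: "real (p div ch_Delta p) \<le> s" .
  have "s * (real N + 2) \<le> s * s" using sN by (intro mult_left_mono) auto
  moreover have "real N * 1 \<le> real N * s" using sN by (intro mult_left_mono) auto
  ultimately have "real N \<le> s * s - 2 * s" by (simp add: algebra_simps)
  then have "real N + real (ch_Delta p) + real (p div ch_Delta p) \<le> real p + 1"
    using D2 D3 ss by linarith
  then have "N + ch_Delta p + p div ch_Delta p \<le> p + 1" by linarith
  then show ?thesis using p(1) by (intro exI[of _ p]) linarith
qed

lemma ch_prime_props:
  "prime (ch_prime N)"
  "int (ch_prime N) - (int (ch_Delta (ch_prime N)) + int (ch_prime N div ch_Delta (ch_prime N)) - 1)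
     \<ge> int N"
  using LeastI_ex[OF ch_prime_candidate[of N]] unfolding ch_prime_def by auto

lemma ch_prime_gt_2:
  assumes "N \<ge> 2"
  shows "ch_prime N > 2"
proof (rule ccontr)
  assume "\<not> ?thesis"
  then have p2: "ch_prime N = 2"
    using prime_ge_2_nat[OF ch_prime_props(1)[of N]] by linarith
  have "\<lceil>sqrt 2\<rceil> = 2" 
    by (rule ceiling_unique) (auto intro: real_le_lsqrt)
  then have "ch_Delta 2 = 2" by (simp add: ch_Delta_def)
  then show False using ch_prime_props(2)[of N] assms p2 by simp
qed

lemma ideal_matrix_exists:
  assumes "prime p" "p > 2"
  shows "\<exists>M. ideal_matrix p M"
proof -
  define M :: "nat \<Rightarrow> nat \<Rightarrow> nat" where "M = (\<lambda>i j. if i = j\<^sup>2 mod p then 1 else 0)"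
  have p0: "p > 0" using assms by simp
  have corr: "ideal_corr p M \<delta> \<tau> \<le> 1" if d: "\<delta> < p" "\<tau> < p" "(\<delta>, \<tau>) \<noteq> (0, 0)" for \<delta> \<tau>
  proof -
    define S where "S = {(i, j). i < p \<and> j < p \<and> i = j\<^sup>2 mod p \<and>
                           (i + \<delta>) mod p = ((j + \<tau>) mod p)\<^sup>2 mod p}"
    have S_sub: "S \<subseteq> {..<p} \<times> {..<p}" by (auto simp: S_def)
    have "ideal_corr p M \<delta> \<tau> =
        (\<Sum>x\<in>{..<p} \<times> {..<p}. if x \<in> S then 1 else 0)"
      unfolding ideal_corr_def sum.cartesian_product
      by (intro sum.cong refl) (auto simp: S_def M_def split: prod.splits)
    also have "\<dots> = card S"
      using S_sub by (simp add: sum.If_cases Int_absorb1)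
    finally have eq: "ideal_corr p M \<delta> \<tau> = card S" .
    have key: "int p dvd (2 * int j * int \<tau> + (int \<tau>)\<^sup>2 - int \<delta>)" if "(i, j) \<in> S" for i j
    proof -
      have "(j\<^sup>2 + \<delta>) mod p = (j + \<tau>)\<^sup>2 mod p"
        using that unfolding S_def by (auto simp: mod_add_left_eq power_mod)
      then have "int (j\<^sup>2 + \<delta>) mod int p = int ((j + \<tau>)\<^sup>2) mod int p"
        by (metis of_nat_mod)
      then have "int p dvd int ((j + \<tau>)\<^sup>2) - int (j\<^sup>2 + \<delta>)"
        by (metis mod_eq_dvd_iff)
      then show ?thesis by (simp add: power2_eq_square algebra_simps)
    qed
    have "j = j'" if j: "(i, j) \<in> S" "(i', j') \<in> S" for i j i' j'
    proof -
      have tau: "\<tau> \<noteq> 0"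
      proof
        assume "\<tau> = 0"
        then have "int p dvd int \<delta>" using key[OF j(1)] by simp
        then have "p dvd \<delta>" by simp
        then have "\<delta> = 0" using d(1) by (auto dest: dvd_imp_le)
        with \<open>\<tau> = 0\<close> d(3) show False by simp
      qed
      have "int p dvd (2 * int j * int \<tau> + (int \<tau>)\<^sup>2 - int \<delta>)
                      - (2 * int j' * int \<tau> + (int \<tau>)\<^sup>2 - int \<delta>)"
        using key[OF j(1)] key[OF j(2)] by (rule dvd_diff)
      then have "int p dvd 2 * int \<tau> * (int j - int j')" by (simp add: algebra_simps)
      moreover have "prime (int p)" using assms by simp
      moreover have "\<not> int p dvd 2" using assms(2) by (auto dest: zdvd_imp_le)
      moreover have "\<not> int p dvd int \<tau>" using tau d(2) by (auto dest: zdvd_imp_le)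
      ultimately have "int p dvd int j - int j'" by (metis prime_dvd_mult_iff)
      then have "int j mod int p = int j' mod int p" by (simp add: mod_eq_dvd_iff)
      then show "j = j'" using j by (auto simp: S_def)
    qed
    moreover have "i = j\<^sup>2 mod p" if "(i, j) \<in> S" for i j
      using that by (simp add: S_def)
    ultimately have "\<forall>x\<in>S. \<forall>y\<in>S. x = y" by (metis surj_pair)
    moreover have "finite S" using S_sub by (rule finite_subset) auto
    ultimately have "card S \<le> 1" by (simp add: card_le_Suc0_iff_eq)
    then show ?thesis using eq by simp
  qed
  have "ideal_matrix p M"
    unfolding ideal_matrix_def
    by (intro conjI allI impI corr) (use p0 in \<open>auto simp: M_def\<close>)
  then show ?thesis by blast
qed

end

(*
  Write C for the channel matrix. Since each row of C is sent twice, a time shift d acts on pairs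
  (i, j) as one fixed shift by some (delta, tau) modulo p. For tau = 0 both entries can be put into
  D, a difference cover of Z/p, in the column j = k. For tau \<noteq> 0, ideality makes the difference of
  the rows of the ones in columns j + tau and j injective in j, hence surjective onto Z/p, so some
  column has difference delta and there both entries can be set to b_k.

  The ratio tends to 2 iff p(N) is asymptotic to N, i.e. iff there is a prime in (x, (1 + eps) x)
  for every eps > 0 and large x. This is proved in the manner of Wiener and Ikehara: the residue at
  s = 1 and the nonvanishing of zeta on Re s = 1 give, for every R > 0, that the sum of
  Lambda(n)/n fejer R (ln n - l) tends to pi as l grows. If there is no prime with
  |ln p - l| < eps, then only prime powers, which are negligible, and the tail |ln n - l| \<ge> eps
  contribute; the tail is O(1/R) by the same limit for R = 1, a contradiction for large R.
*)
theory Submission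
  imports Defs "HOL-Complex_Analysis.Complex_Analysis" "HOL-Number_Theory.Prime_Powers"
    "HOL-Probability.Sinc_Integral" "HOL-Real_Asymp.Real_Asymp"
begin

section \<open>The Riemann zeta function\<close>

text \<open>The Fejer kernel is nonnegative, so weighted sums can be compared term by term, and its
  Fourier transform has compact support, so only the segment 0 <= t <= R of the line Re s = 1 enters
  for each R. The limit pi comes from the pole alone: one half is the mass of a Poisson kernel, the
  other half the limit of the sine integral. The regular remainder dies by Riemann-Lebesgue, since
  it is continuously differentiable on the segment. As pi is the same for all R while the tail
  carries a factor 1/R, one fixed R decides. The sum with exponent 1 is never formed. Every
  inequality is proved between convergent series for \<sigma> > 1, and only the limits for \<sigma>
  tending to 1, called \<open>smooth_limit\<close>, are compared. On the combinatorial side, the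
  amount subtracted from p in the choice of p(N) is at most 2 sqrt p, hence of lower order, so the
  ratio depends only on gaps between primes. A bound of Bertrand type would merely keep the ratio
  bounded.\<close>

definition dirichlet_zeta :: "complex \<Rightarrow> complex" where
  "dirichlet_zeta s = (\<Sum>n. of_nat n powr - s)"

definition mangoldt_series :: "complex \<Rightarrow> complex" where
  "mangoldt_series s = (\<Sum>n. mangoldt n * of_nat n powr - s)"

text \<open>
  Summed over all \<open>n\<close>, the last two summands telescope to zero for \<open>Re s > 1\<close>, so \<open>reg_zeta\<close> below
  extends \<open>(s - 1) \<zeta>(s)\<close>. As \<open>0 powr z = 0\<close>, also for \<open>z = 0\<close>, the term for \<open>n = 0\<close> is \<open>1\<close>.
\<close>

definition zeta_term :: "complex \<Rightarrow> nat \<Rightarrow> complex" where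
  "zeta_term s n = (s - 1) * of_nat n powr - s + of_nat (Suc n) powr (1 - s) - of_nat n powr (1 - s)"

definition reg_zeta :: "complex \<Rightarrow> complex" where
  "reg_zeta s = (\<Sum>n. zeta_term s n)"

section \<open>Continuation of (s - 1) zeta(s) to Re s > 0\<close>

lemma norm_of_nat_powr: "norm (of_nat n powr (s :: complex)) = real n powr Re s"
  using norm_powr_real_powr[of "of_nat n" s] by simp

lemma norm_of_real_powr: "x \<ge> 0 \<Longrightarrow> norm (of_real x powr (s :: complex)) = x powr Re s"
  using norm_powr_real_powr[of "of_real x" s] by simp

text \<open>The term is (s - 1) times the integral of n^-s - x^-s over [n, n + 1]. The difference
  gains a factor 1/n over n^-s, which moves convergence from Re s > 1 to Re s > 0. In place of the
  integral, the mean value inequality is used twice: for z^-s, then for a function whose increment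
  is the term.\<close>

lemma norm_zeta_term_le:
  assumes s: "Re s > 0" and n: "n > 0"
  shows "norm (zeta_term s n) \<le> norm (s - 1) * norm s * real n powr (- Re s - 1)"
proof -
  define a :: complex where "a = of_nat n"
  define S where "S = closed_segment a (a + 1)"
  define B where "B = norm s * real n powr (- Re s - 1)"
  have S: "\<exists>x\<ge>real n. z = of_real x \<and> norm (a - z) \<le> 1" if z: "z \<in> S" for z
  proof -
    obtain u where u: "0 \<le> u" "u \<le> 1" "z = (1 - u) *\<^sub>R a + u *\<^sub>R (a + 1)"
      using z by (auto simp: S_def in_segment)
    have "z = of_real (real n + u)" using u(3) by (simp add: a_def algebra_simps scaleR_conv_of_real)
    then show ?thesis using u by (intro exI[of _ "real n + u"]) (auto simp: a_def)
  qed
  have nonneg: "z \<notin> \<real>\<^sub>\<le>\<^sub>0" if "z \<in> S" for z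
    using S[OF that] n by (auto simp: complex_nonpos_Reals_iff)
  have conv: "convex S" by (simp add: S_def)
  have ends: "a \<in> S" "a + 1 \<in> S" by (auto simp: S_def)
  have 1: "norm (a powr - s - z powr - s) \<le> B" if z: "z \<in> S" for z
  proof -
    have "norm (a powr - s - z powr - s) \<le> B * norm (a - z)"
    proof (rule field_differentiable_bound[OF conv, where f' = "\<lambda>z. - s * z powr (- s - 1)"])
      fix w assume w: "w \<in> S"
      show "((\<lambda>z. z powr - s) has_field_derivative - s * w powr (- s - 1)) (at w within S)"
        using has_field_derivative_powr[OF nonneg[OF w], of "- s"]
        by (rule has_field_derivative_at_within)
      obtain x where x: "x \<ge> real n" "w = of_real x" using S[OF w] by blast
      have "norm (w powr (- s - 1)) = x powr (- Re s - 1)"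
        using x norm_of_real_powr[of x "- s - 1"] by simp
      also have "\<dots> \<le> real n powr (- Re s - 1)"
        using x n s by (intro powr_mono2') auto
      finally show "norm (- s * w powr (- s - 1)) \<le> B"
        by (simp add: B_def norm_mult mult_left_mono)
    qed (use ends z in auto)
    also have "\<dots> \<le> B * 1"
      using S[OF z] by (intro mult_left_mono) (auto simp: B_def)
    finally show ?thesis by simp
  qed
  \<comment> \<open>Its derivative (s - 1) * (a powr - s - z powr - s) is controlled by the first
    estimate, and its increment from \<open>a\<close> to \<open>a + 1\<close> is
    \<open>zeta_term s n\<close>.\<close>
  define v where "v = (\<lambda>z. (s - 1) * a powr - s * z + z powr (1 - s))"
  have "norm (v (a + 1) - v a) \<le> (norm (s - 1) * B) * norm ((a + 1) - a)"
  proof (rule field_differentiable_bound[OF conv, where f' = "\<lambda>z. (s - 1) * (a powr - s - z powr - s)"])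
    fix w assume w: "w \<in> S"
    have "(v has_field_derivative (s - 1) * a powr - s * 1 + (1 - s) * w powr (1 - s - 1)) (at w)"
      unfolding v_def
      by (rule DERIV_add[OF DERIV_cmult[OF DERIV_ident] has_field_derivative_powr[OF nonneg[OF w]]])
    also have "(s - 1) * a powr - s * 1 + (1 - s) * w powr (1 - s - 1) = (s - 1) * (a powr - s - w powr - s)"
      by (simp add: algebra_simps)
    finally show "(v has_field_derivative (s - 1) * (a powr - s - w powr - s)) (at w within S)"
      by (rule has_field_derivative_at_within)
    show "norm ((s - 1) * (a powr - s - w powr - s)) \<le> norm (s - 1) * B"
      using 1[OF w] by (simp add: norm_mult mult_left_mono)
  qed (use ends in auto)
  moreover have "v (a + 1) - v a = zeta_term s n"
    by (simp add: v_def zeta_term_def a_def algebra_simps)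
  ultimately show ?thesis by (simp add: B_def mult_ac)
qed

lemma has_field_derivative_of_nat_powr:
  "((\<lambda>s. of_nat n powr - s :: complex) has_field_derivative - (of_real (ln (real n)) * of_nat n powr - s)) (at s)"
proof (cases "n = 0")
  case False
  then have "((\<lambda>s. of_nat n powr - s) has_field_derivative
      Ln (of_nat n) * of_nat n powr - s * - 1) (at s)"
    by (intro DERIV_chain2[OF has_field_derivative_powr_right]) (auto intro!: derivative_eq_intros)
  then show ?thesis using False by (simp add: Ln_of_nat)
qed auto

lemma has_field_derivative_zeta_term:
  "\<exists>D. ((\<lambda>s. zeta_term s n) has_field_derivative D) (at s)"
proof -
  have *: "\<exists>D. ((\<lambda>s. of_nat m powr (1 - s) :: complex) has_field_derivative D) (at s)" for m :: nat
  proof (cases "m = 0")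
    case False
    then have "((\<lambda>s. of_nat m powr (1 - s)) has_field_derivative
        Ln (of_nat m) * of_nat m powr (1 - s) * (0 - 1)) (at s)"
      by (intro DERIV_chain2[OF has_field_derivative_powr_right]) (auto intro!: derivative_eq_intros)
    then show ?thesis by blast
  qed (auto intro: exI[of _ 0])
  obtain D1 D2 where D: "((\<lambda>s. of_nat (Suc n) powr (1 - s) :: complex) has_field_derivative D1) (at s)"
    "((\<lambda>s. of_nat n powr (1 - s) :: complex) has_field_derivative D2) (at s)"
    using *[of "Suc n"] *[of n] by blast
  have "((\<lambda>s. (s - 1) * of_nat n powr - s :: complex) has_field_derivative
      (s - 1) * - (of_real (ln (real n)) * of_nat n powr - s) + 1 * of_nat n powr - s) (at s)"
    by (rule DERIV_mult'[OF _ has_field_derivative_of_nat_powr]) (auto intro!: derivative_eq_intros)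
  from DERIV_diff[OF DERIV_add[OF this D(1)] D(2)] show ?thesis
    unfolding zeta_term_def by blast
qed

lemma ball_Re_ge:
  assumes "y \<in> ball x d"
  shows "Re y \<ge> Re x - d" "norm y \<le> norm x + d"
proof -
  have "\<bar>Re x - Re y\<bar> \<le> norm (x - y)" "norm (x - y) < d"
    using abs_Re_le_cmod[of "x - y"] assms by (auto simp: dist_norm)
  then show "Re y \<ge> Re x - d" by linarith
  have "norm y \<le> norm x + norm (x - y)" by norm
  then show "norm y \<le> norm x + d" using \<open>norm (x - y) < d\<close> by linarith
qed

lemma open_Re_gt: "open {s. Re s > c}"
  by (rule open_halfspace_Re_gt)

lemma holomorphic_reg_zeta: "reg_zeta holomorphic_on {s. Re s > 0}"
proof -
  obtain D where D: "\<And>n x. ((\<lambda>s. zeta_term s n) has_field_derivative D n x) (at x)"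
    using has_field_derivative_zeta_term by metis
  have "\<exists>g g'. \<forall>x\<in>{s. Re s > 0}. ((\<lambda>n. zeta_term x n) sums g x) \<and> ((\<lambda>n. D n x) sums g' x) \<and>
      (g has_field_derivative g' x) (at x)"
  proof (rule series_and_derivative_comparison_local)
    fix x :: complex assume "x \<in> {s. Re s > 0}"
    then have x: "Re x > 0" by simp
    \<comment> \<open>Half the distance to the line Re s = 0: on the ball Re y >= d > 0, so n^(-d -
      1) is a summable majorant.\<close>
    define d where "d = Re x / 2"
    define h where "h = (\<lambda>n. (norm x + d + 1) * (norm x + d) * real n powr (- d - 1))"
    have "norm (zeta_term y n) \<le> h n" if "n \<ge> 1" "y \<in> ball x d" for n y
    proof -
      have y: "Re y \<ge> d" "norm y \<le> norm x + d"
        using ball_Re_ge[OF that(2)] by (auto simp: d_def)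
      have "norm (y - 1) \<le> norm x + d + 1"
        using norm_triangle_ineq4[of y 1] y by simp
      then have "norm (y - 1) * norm y * real n powr (- Re y - 1)
          \<le> (norm x + d + 1) * (norm x + d) * real n powr (- d - 1)"
        using y that x by (intro mult_mono powr_mono) (auto simp: d_def add_nonneg_nonneg)
      moreover have "norm (zeta_term y n) \<le> norm (y - 1) * norm y * real n powr (- Re y - 1)"
        using y x that by (intro norm_zeta_term_le) (auto simp: d_def)
      ultimately show ?thesis by (simp add: h_def)
    qed
    then have "\<forall>\<^sub>F n in sequentially. \<forall>y\<in>ball x d \<inter> {s. Re s > 0}. norm (zeta_term y n) \<le> h n"
      by (auto intro: eventually_sequentiallyI[of 1])
    moreover have "summable h"
      unfolding h_def using x by (intro summable_mult) (auto simp: summable_real_powr_iff d_def)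
    ultimately show "\<exists>d h. 0 < d \<and> summable h \<and>
        (\<forall>\<^sub>F n in sequentially. \<forall>y\<in>ball x d \<inter> {s. Re s > 0}. norm (zeta_term y n) \<le> h n)"
      using x by (intro exI[of _ d] exI[of _ h]) (auto simp: d_def)
  qed (auto simp: open_Re_gt D)
  then obtain g g' where g: "\<And>x. Re x > 0 \<Longrightarrow> zeta_term x sums g x"
    "\<And>x. Re x > 0 \<Longrightarrow> (g has_field_derivative g' x) (at x)" by auto
  have "g holomorphic_on {s. Re s > 0}"
    using g(2) by (auto simp: holomorphic_on_open[OF open_Re_gt])
  moreover have "g x = reg_zeta x" if "x \<in> {s. Re s > 0}" for x
    using g(1)[of x] that by (auto simp: reg_zeta_def sums_iff)
  ultimately show "reg_zeta holomorphic_on {s. Re s > 0}"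
    by (rule holomorphic_transform)
qed

text \<open>This is the residue of zeta at 1. It also supplies the point at which
  \<open>reg_zeta\<close> is nonzero, so that all its zeros have finite order.\<close>

lemma reg_zeta_1: "reg_zeta 1 = 1"
proof -
  have "zeta_term 1 = (\<lambda>n. if n = 0 then 1 else 0)"
    using of_nat_neq_0[where ?'a = complex]
    by (auto simp: zeta_term_def fun_eq_iff powr_def)
  then show ?thesis
    using suminf_finite[of "{0}" "\<lambda>n. if n = (0::nat) then 1 else 0 :: complex"]
    by (simp add: reg_zeta_def)
qed

lemma summable_norm_of_nat_powr:
  assumes "Re s > 1"
  shows "summable (\<lambda>n. norm (of_nat n powr - s :: complex))"
  using assms by (simp add: norm_of_nat_powr summable_real_powr_iff)

lemma reg_zeta_eq:
  assumes s: "Re s > 1"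
  shows "reg_zeta s = (s - 1) * dirichlet_zeta s"
proof -
  have "(\<lambda>n. of_nat n powr (1 - s)) \<longlonglongrightarrow> (0 :: complex)"
    using s by (intro tendsto_neg_powr_complex_of_nat filterlim_ident) auto
  from telescope_sums[OF this]
  have "(\<lambda>n. of_nat (Suc n) powr (1 - s) - of_nat n powr (1 - s)) sums (0 :: complex)" by simp
  moreover have "(\<lambda>n. of_nat n powr - s :: complex) sums dirichlet_zeta s"
    unfolding dirichlet_zeta_def
    by (rule summable_sums[OF summable_norm_cancel[OF summable_norm_of_nat_powr[OF s]]])
  ultimately have "(\<lambda>n. (s - 1) * of_nat n powr - s + (of_nat (Suc n) powr (1 - s) - of_nat n powr (1 - s)))
      sums ((s - 1) * dirichlet_zeta s + 0)"
    by (intro sums_add sums_mult)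
  then show ?thesis
    unfolding reg_zeta_def zeta_term_def by (simp add: sums_iff add_diff_eq)
qed

section \<open>The Dirichlet series of the von Mangoldt function\<close>

lemma summable_ln_powr:
  assumes "\<sigma> > 1"
  shows "summable (\<lambda>n. ln (real n) * real n powr - \<sigma>)"
proof (rule summable_comparison_test)
  \<comment> \<open>Half of the room \<sigma> - 1 pays for ln n <= n^e / e, the other half keeps the
    exponent below -1.\<close>
  define e where "e = (\<sigma> - 1) / 2"
  have e: "e > 0" "e - \<sigma> < - 1" using assms by (auto simp: e_def field_simps)
  show "summable (\<lambda>n. 1 / e * real n powr (e - \<sigma>))"
    using e by (intro summable_mult) (simp add: summable_real_powr_iff)
  have "norm (ln (real n) * real n powr - \<sigma>) \<le> 1 / e * real n powr (e - \<sigma>)" if "n \<ge> 1" for n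
  proof -
    have "ln (real n) * real n powr - \<sigma> \<le> (real n powr e / e) * real n powr - \<sigma>"
      using that e by (intro mult_right_mono ln_powr_bound) auto
    also have "\<dots> = 1 / e * real n powr (e - \<sigma>)"
      using powr_add[of "real n" e "- \<sigma>"] by simp
    finally show ?thesis using that by (simp add: abs_mult)
  qed
  then show "\<exists>N. \<forall>n\<ge>N. norm (ln (real n) * real n powr - \<sigma>) \<le> 1 / e * real n powr (e - \<sigma>)" by blast
qed

lemma summable_mangoldt_powr:
  assumes "\<sigma> > 1"
  shows "summable (\<lambda>n. mangoldt n * real n powr - \<sigma>)"
proof (rule summable_comparison_test)
  have "norm (mangoldt n * real n powr - \<sigma>) \<le> ln (real n) * real n powr - \<sigma>" if "n \<ge> 1" for n
    using that mangoldt_le[of n] by (auto simp: abs_mult intro!: mult_right_mono)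
  then show "\<exists>N. \<forall>n\<ge>N. norm (mangoldt n * real n powr - \<sigma>) \<le> ln (real n) * real n powr - \<sigma>" by blast
qed (rule summable_ln_powr[OF assms])

lemma norm_mangoldt_powr:
  "norm (mangoldt n * of_nat n powr s :: complex) = mangoldt n * real n powr Re s"
  by (simp add: norm_mult norm_of_nat_powr)

lemma summable_norm_mangoldt_series:
  assumes "Re s > 1"
  shows "summable (\<lambda>n. norm (mangoldt n * of_nat n powr - s :: complex))"
  using summable_mangoldt_powr[OF assms] by (simp add: norm_mangoldt_powr)

lemma mangoldt_series_sums:
  assumes "Re s > 1"
  shows "(\<lambda>n. mangoldt n * of_nat n powr - s) sums mangoldt_series s"
  unfolding mangoldt_series_def
  by (rule summable_sums[OF summable_norm_cancel[OF summable_norm_mangoldt_series[OF assms]]])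

lemma has_field_derivative_dirichlet_zeta:
  assumes s: "Re s > 1"
  shows "(dirichlet_zeta has_field_derivative - (\<Sum>n. of_real (ln (real n)) * of_nat n powr - s)) (at s)"
proof -
  have "\<exists>g g'. \<forall>x\<in>{s. Re s > 1}. ((\<lambda>n. of_nat n powr - x) sums g x) \<and>
      ((\<lambda>n. - (of_real (ln (real n)) * of_nat n powr - x)) sums g' x) \<and>
      (g has_field_derivative g' x) (at x)"
  proof (rule series_and_derivative_comparison_local)
    fix x :: complex assume "x \<in> {s. Re s > 1}"
    then have x: "Re x > 1" by simp
    define d where "d = (Re x - 1) / 2"
    define h where "h = (\<lambda>n. real n powr (- d - 1))"
    have "norm (of_nat n powr - y :: complex) \<le> h n" if "n \<ge> 1" "y \<in> ball x d" for n y
    proof -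
      have y: "Re y \<ge> 1 + d" using ball_Re_ge[OF that(2)] by (auto simp: d_def field_simps)
      then show ?thesis
        unfolding norm_of_nat_powr h_def using that(1) by (intro powr_mono) auto
    qed
    then have "\<forall>\<^sub>F n in sequentially. \<forall>y\<in>ball x d \<inter> {s. Re s > 1}. norm (of_nat n powr - y :: complex) \<le> h n"
      by (auto intro: eventually_sequentiallyI[of 1])
    moreover have "summable h"
      unfolding h_def using x by (auto simp: summable_real_powr_iff d_def)
    ultimately show "\<exists>d h. 0 < d \<and> summable h \<and>
        (\<forall>\<^sub>F n in sequentially. \<forall>y\<in>ball x d \<inter> {s. Re s > 1}. norm (of_nat n powr - y :: complex) \<le> h n)"
      using x by (intro exI[of _ d] exI[of _ h]) (auto simp: d_def)
  qed (auto simp: open_Re_gt intro: has_field_derivative_of_nat_powr)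
  then obtain g g' where g: "\<And>x. Re x > 1 \<Longrightarrow> (\<lambda>n. of_nat n powr - x) sums g x"
    "\<And>x. Re x > 1 \<Longrightarrow> (\<lambda>n. - (of_real (ln (real n)) * of_nat n powr - x)) sums g' x"
    "\<And>x. Re x > 1 \<Longrightarrow> (g has_field_derivative g' x) (at x)" by auto
  have eq: "g x = dirichlet_zeta x" if "x \<in> {s. Re s > 1}" for x
    using g(1)[of x] that by (auto simp: dirichlet_zeta_def sums_iff)
  have "(dirichlet_zeta has_field_derivative g' s) (at s)"
    using g(3)[OF s] by (rule has_field_derivative_transform_within_open[OF _ open_Re_gt _ eq]) (use s in auto)
  moreover have "g' s = - (\<Sum>n. of_real (ln (real n)) * of_nat n powr - s)"
    using sums_minus[OF g(2)[OF s]] by (simp add: sums_iff)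
  ultimately show ?thesis by simp
qed

text \<open>The values of the von Mangoldt function at the divisors of n add up to ln n; the rest is
  a regrouping of the absolutely convergent double sum over (d, m) by n = d m.\<close>

lemma mangoldt_series_mult_zeta:
  assumes s: "Re s > 1"
  shows "mangoldt_series s * dirichlet_zeta s = (\<Sum>n. of_real (ln (real n)) * of_nat n powr - s)"
proof -
  define a b where "a = (\<lambda>n. of_nat n powr - s :: complex)" and "b = (\<lambda>n. mangoldt n * of_nat n powr - s :: complex)"
  \<comment> \<open>Zero has infinitely many divisors; only among positive numbers do the pairs (d,
    m) correspond to pairs of a number n = d m and a divisor d of it.\<close>
  define A :: "nat set" where "A = {0<..}"
  have drop0: "(f has_sum S) A" if "f 0 = 0" "(f has_sum S) (UNIV :: nat set)" for f :: "nat \<Rightarrow> complex" and S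
    by (rule has_sum_cong_neutral[THEN iffD1, OF _ _ _ that(2)]) (use that(1) in \<open>auto simp: A_def\<close>)
  have a: "(a has_sum dirichlet_zeta s) A"
    using norm_summable_imp_has_sum[OF summable_norm_of_nat_powr[OF s]
      summable_sums[OF summable_norm_cancel[OF summable_norm_of_nat_powr[OF s]]]]
    unfolding a_def dirichlet_zeta_def by (intro drop0) auto
  have b: "(b has_sum mangoldt_series s) A"
    using norm_summable_imp_has_sum[OF summable_norm_mangoldt_series[OF s] mangoldt_series_sums[OF s]]
    unfolding b_def by (intro drop0) auto
  have abs: "(\<lambda>n. norm (f n)) summable_on A" if "summable (\<lambda>n. norm (f n))" for f :: "nat \<Rightarrow> complex"
    using that summable_on_UNIV_nonneg_real_iff[of "\<lambda>n. norm (f n)"]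
      summable_on_subset_banach[OF _ subset_UNIV] by auto
  have na: "(\<lambda>n. norm (a n)) summable_on A" and nb: "(\<lambda>n. norm (b n)) summable_on A"
    unfolding a_def b_def
    by (rule abs[OF summable_norm_of_nat_powr[OF s]], rule abs[OF summable_norm_mangoldt_series[OF s]])
  have "(\<lambda>x. norm (case x of (d, m) \<Rightarrow> b d * a m)) summable_on A \<times> A"
  proof (rule Infinite_Sum.abs_summable_on_Sigma_iff[THEN iffD2], intro conjI ballI)
    show "(\<lambda>m. norm (case (d, m) of (d, m) \<Rightarrow> b d * a m)) summable_on A" for d
      using summable_on_cmult_right[OF na, of "norm (b d)"] by (simp add: norm_mult)
    have "norm (\<Sum>\<^sub>\<infinity>m\<in>A. norm (case (d, m) of (d, m) \<Rightarrow> b d * a m)) = norm (b d) * (\<Sum>\<^sub>\<infinity>m\<in>A. norm (a m))" for d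
      by (simp add: norm_mult infsum_cmult_right' abs_mult infsum_nonneg)
    then show "(\<lambda>d. norm (\<Sum>\<^sub>\<infinity>m\<in>A. norm (case (d, m) of (d, m) \<Rightarrow> b d * a m))) summable_on A"
      using summable_on_cmult_left[OF nb] by simp
  qed
  then have summ: "(\<lambda>(d, m). b d * a m) summable_on A \<times> A"
    by (rule Infinite_Sum.abs_summable_summable)
  have "((\<lambda>(d, m). b d * a m) has_sum (mangoldt_series s * dirichlet_zeta s)) (A \<times> A)"
  proof (rule has_sum_SigmaI[OF _ _ summ])
    show "((\<lambda>m. case (d, m) of (d, m) \<Rightarrow> b d * a m) has_sum b d * dirichlet_zeta s) A" for d
      using a by (simp add: has_sum_cmult_right)
    show "((\<lambda>d. b d * dirichlet_zeta s) has_sum mangoldt_series s * dirichlet_zeta s) A"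
      using b by (rule has_sum_cmult_left)
  qed
  also have "?this \<longleftrightarrow> ((\<lambda>(n, d). b d * a (n div d)) has_sum (mangoldt_series s * dirichlet_zeta s))
      (Sigma A (\<lambda>n. {d. d dvd n}))"
    by (rule has_sum_reindex_bij_witness[where j = "\<lambda>(d, m). (d * m, d)" and i = "\<lambda>(n, d). (d, n div d)"])
      (auto simp: A_def elim!: dvdE)
  finally have *: "((\<lambda>(n, d). b d * a (n div d)) has_sum (mangoldt_series s * dirichlet_zeta s))
      (Sigma A (\<lambda>n. {d. d dvd n}))" .
  have "((\<lambda>n. of_real (ln (real n)) * of_nat n powr - s) has_sum (mangoldt_series s * dirichlet_zeta s)) A"
  proof (rule has_sum_SigmaD[OF *])
    fix n assume "n \<in> A"
    then have n: "n > 0" by (simp add: A_def)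
    have "(\<Sum>d | d dvd n. b d * a (n div d)) = (\<Sum>d | d dvd n. mangoldt d * of_nat n powr - s)"
    proof (rule sum.cong[OF refl])
      fix d assume "d \<in> {d. d dvd n}"
      then obtain m where m: "n = d * m" by auto
      with n have "d > 0" by auto
      have "of_nat n powr - s = (of_nat d powr - s * of_nat m powr - s :: complex)"
        by (simp add: m powr_times_real)
      then show "b d * a (n div d) = mangoldt d * of_nat n powr - s"
        using \<open>d > 0\<close> by (simp add: a_def b_def m)
    qed
    also have "\<dots> = of_real (ln (real n)) * of_nat n powr - s"
      using mangoldt_sum[of n, where ?'a = complex] n by (simp flip: sum_distrib_right)
    finally show "((\<lambda>d. case (n, d) of (n, d) \<Rightarrow> b d * a (n div d)) has_sum
        of_real (ln (real n)) * of_nat n powr - s) {d. d dvd n}"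
      using has_sum_finite[of "{d. d dvd n}" "\<lambda>d. b d * a (n div d)"] n by simp
  qed
  then have "((\<lambda>n. of_real (ln (real n)) * of_nat n powr - s) has_sum (mangoldt_series s * dirichlet_zeta s)) UNIV"
    by (rule has_sum_cong_neutral[THEN iffD1, rotated -1]) (auto simp: A_def)
  then show ?thesis by (simp add: has_sum_imp_sums sums_unique)
qed

text \<open>This is \<open>mangoldt_series\<close> = -zeta'/zeta, multiplied by
  \<open>reg_zeta s\<close> because the nonvanishing of that factor is itself derived from this
  identity.\<close>

lemma deriv_reg_zeta:
  assumes s: "Re s > 1"
  shows "reg_zeta s * mangoldt_series s = reg_zeta s / (s - 1) - deriv reg_zeta s"
proof -
  define T where "T = (\<Sum>n. of_real (ln (real n)) * of_nat n powr - s :: complex)"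
  have s1: "s \<noteq> 1" using s by auto
  have "((\<lambda>s. (s - 1) * dirichlet_zeta s) has_field_derivative (s - 1) * (- T) + 1 * dirichlet_zeta s) (at s)"
    using has_field_derivative_dirichlet_zeta[OF s] unfolding T_def
    by (intro DERIV_mult') (auto intro!: derivative_eq_intros)
  then have "(reg_zeta has_field_derivative (s - 1) * (- T) + 1 * dirichlet_zeta s) (at s)"
    by (rule has_field_derivative_transform_within_open[OF _ open_Re_gt[of 1]])
      (use s reg_zeta_eq in auto)
  then have "deriv reg_zeta s = (s - 1) * (- T) + dirichlet_zeta s"
    by (simp add: DERIV_imp_deriv)
  also have "T = mangoldt_series s * dirichlet_zeta s"
    by (simp add: T_def mangoldt_series_mult_zeta[OF s])
  finally have "deriv reg_zeta s = (s - 1) * - (mangoldt_series s * dirichlet_zeta s) + dirichlet_zeta s" .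
  moreover have "reg_zeta s / (s - 1) = dirichlet_zeta s" using s1 by (simp add: reg_zeta_eq[OF s])
  ultimately show ?thesis by (simp add: reg_zeta_eq[OF s])
qed

section \<open>Nonvanishing on the line \<open>Re s = 1\<close>\<close>

text \<open>Order n = 0, with f as its own cofactor, is included so that one residue computation
  serves zeros and nonzeros alike. The point w excludes the zero function, which has no finite
  order.\<close>

lemma holomorphic_factor_order:
  assumes holf: "f holomorphic_on S" and S: "open S" "connected S"
    and z: "z \<in> S" and w: "w \<in> S" "f w \<noteq> 0"
  obtains g r n where "0 < r" "ball z r \<subseteq> S" "g holomorphic_on ball z r"
    "\<And>w. w \<in> ball z r \<Longrightarrow> f w = (w - z) ^ n * g w" "\<And>w. w \<in> ball z r \<Longrightarrow> g w \<noteq> 0"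
    "f z = 0 \<longleftrightarrow> n > 0"
proof (cases "f z = 0")
  case True
  then have "\<not> f constant_on S" using z w unfolding constant_on_def by metis
  from holomorphic_factor_zero_nonconstant[OF holf S z True this] that True show ?thesis
    by metis
next
  case False
  have "continuous_on S f" using holf by (rule holomorphic_on_imp_continuous_on)
  then obtain r1 where r1: "r1 > 0" "\<And>y. dist z y < r1 \<Longrightarrow> f y \<noteq> 0"
    using continuous_on_open_avoid[of S f z 0] S(1) z False by metis
  obtain r2 where r2: "r2 > 0" "ball z r2 \<subseteq> S" using S z by (auto simp: open_contains_ball)
  show ?thesis
    by (rule that[of "min r1 r2" f 0])
      (use r1 r2 False in \<open>auto intro!: holomorphic_on_subset[OF holf]\<close>)
qed

text \<open>From f = (u - z)^m g one gets f'/f = m / (u - z) + g'/g, where g'/g is continuous at z.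
  The approach is from the right because for Re z = 1 this stays inside the half-plane where
  \<open>mangoldt_series\<close> converges.\<close>

lemma logarithmic_derivative_residue:
  assumes holf: "f holomorphic_on S" and S: "open S" "connected S"
    and z: "z \<in> S" and w: "w \<in> S" "f w \<noteq> 0"
  obtains m :: nat where "f z = 0 \<longleftrightarrow> m > 0"
    "((\<lambda>\<eta>. of_real \<eta> * (deriv f (z + of_real \<eta>) / f (z + of_real \<eta>))) \<longlongrightarrow> of_nat m) (at_right 0)"
    "\<forall>\<^sub>F \<eta> in at_right 0. f (z + of_real \<eta>) \<noteq> 0"
proof -
  from holomorphic_factor_order[OF assms] obtain g r n where r: "0 < r" "ball z r \<subseteq> S"
    and holg: "g holomorphic_on ball z r" and fg: "\<And>w. w \<in> ball z r \<Longrightarrow> f w = (w - z) ^ n * g w"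
    and g: "\<And>w. w \<in> ball z r \<Longrightarrow> g w \<noteq> 0" and n: "f z = 0 \<longleftrightarrow> n > 0" by metis
  have ev: "\<forall>\<^sub>F \<eta> in at_right 0. 0 < \<eta> \<and> \<eta> < r"
    using r(1) by (auto simp: eventually_at_right)
  have ball: "z + of_real \<eta> \<in> ball z r" if "0 < \<eta>" "\<eta> < r" for \<eta>
    using that by (simp add: dist_norm)
  have eq: "of_real \<eta> * (deriv f (z + of_real \<eta>) / f (z + of_real \<eta>)) =
      of_nat n + of_real \<eta> * (deriv g (z + of_real \<eta>) / g (z + of_real \<eta>))"
    if \<eta>: "0 < \<eta>" "\<eta> < r" for \<eta>
  proof -
    define u where "u = z + of_real \<eta>"
    have u: "u \<in> ball z r" using ball[OF \<eta>] by (simp add: u_def)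
    have "(g has_field_derivative deriv g u) (at u)"
      using holg u by (simp add: holomorphic_derivI)
    then have "((\<lambda>w. (w - z) ^ n * g w) has_field_derivative
        (u - z) ^ n * deriv g u + of_nat n * (u - z) ^ (n - 1) * g u) (at u)"
      by (auto intro!: derivative_eq_intros)
    then have "(f has_field_derivative (u - z) ^ n * deriv g u + of_nat n * (u - z) ^ (n - 1) * g u) (at u)"
      by (rule has_field_derivative_transform_within_open[OF _ open_ball u]) (simp add: fg)
    then have deriv: "deriv f u = (u - z) ^ n * deriv g u + of_nat n * (u - z) ^ (n - 1) * g u"
      by (rule DERIV_imp_deriv)
    \<comment> \<open>For n = 0 the exponent n - 1 truncates to 0, and the factor
      \<open>of_nat n\<close> keeps the identity true.\<close>
    have power: "(u - z) * (of_nat n * (u - z) ^ (n - 1)) = of_nat n * (u - z) ^ n"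
      by (cases n) auto
    have uz: "u - z = of_real \<eta>" "u - z \<noteq> 0" using \<eta> by (auto simp: u_def)
    have "x * (A * g1 + B * g0) = A * (x * g1 + N * g0)" if "x * B = N * A" for x A B N g0 g1 :: complex
    proof -
      have "x * (A * g1 + B * g0) = A * (x * g1) + (x * B) * g0" by (simp add: algebra_simps)
      then show ?thesis using that by (simp add: algebra_simps)
    qed
    from this[OF power]
    have "of_real \<eta> * deriv f u = (u - z) ^ n * (of_real \<eta> * deriv g u + of_nat n * g u)"
      unfolding deriv uz(1) .
    then have "of_real \<eta> * deriv f u / f u = (of_real \<eta> * deriv g u + of_nat n * g u) / g u"
      unfolding fg[OF u] using uz(2) by (metis mult_divide_mult_cancel_left power_not_zero)
    also have "\<dots> = of_nat n + of_real \<eta> * deriv g u / g u" using g[OF u] by (simp add: field_simps)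
    finally show ?thesis by (simp add: u_def)
  qed
  have cont: "isCont (\<lambda>u. deriv g u / g u) z"
  proof -
    have "(\<lambda>u. deriv g u / g u) holomorphic_on ball z r"
      using holg g by (intro holomorphic_intros) auto
    then show ?thesis
      using holomorphic_on_imp_continuous_on continuous_on_interior r(1)
      by (metis centre_in_ball interior_ball)
  qed
  have lim: "((\<lambda>\<eta>::real. z + of_real \<eta>) \<longlongrightarrow> z) (at_right 0)"
    by (auto intro!: tendsto_eq_intros)
  have "((\<lambda>\<eta>. of_nat n + of_real \<eta> * (deriv g (z + of_real \<eta>) / g (z + of_real \<eta>))) \<longlongrightarrow>
      of_nat n + of_real 0 * (deriv g z / g z)) (at_right 0)"
    by (intro tendsto_add tendsto_const tendsto_mult tendsto_of_real tendsto_ident_at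
        isCont_tendsto_compose[OF cont lim])
  then have "((\<lambda>\<eta>. of_nat n + of_real \<eta> * (deriv g (z + of_real \<eta>) / g (z + of_real \<eta>))) \<longlongrightarrow> of_nat n)
      (at_right 0)" by simp
  then have 1: "((\<lambda>\<eta>. of_real \<eta> * (deriv f (z + of_real \<eta>) / f (z + of_real \<eta>))) \<longlongrightarrow> of_nat n) (at_right 0)"
    by (rule Lim_transform_eventually) (use ev in \<open>eventually_elim, use eq in simp\<close>)
  have 2: "\<forall>\<^sub>F \<eta> in at_right 0. f (z + of_real \<eta>) \<noteq> 0"
    using ev by eventually_elim (use fg g ball in auto)
  show ?thesis using that[OF n 1 2] .
qed

section \<open>The 3-4-1 inequality and the residues of \<open>mangoldt_series\<close>\<close>

lemma of_nat_powr_Complex: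
  assumes "n > 0"
  shows "of_nat n powr - Complex \<sigma> t = of_real (real n powr - \<sigma>) * cis (- (t * ln (real n)))"
proof -
  have "- Complex \<sigma> t * Ln (of_nat n) = Complex (- \<sigma> * ln (real n)) (- (t * ln (real n)))"
    using assms by (simp add: Ln_of_nat complex_eq_iff)
  then show ?thesis
    using assms by (simp add: powr_def exp_eq_polar del: exp_of_real)
qed

text \<open>Multiplication by \<open>cis (t * l)\<close> moves the phase origin from ln n = 0 to ln
  n = l. The 3-4-1 inequality uses l = 0, the Fejer sums use general l.\<close>

lemma mangoldt_series_cos_sums:
  assumes "\<sigma> > 1"
  shows "(\<lambda>n. mangoldt n * real n powr - \<sigma> * cos (t * (ln (real n) - l))) sums
           Re (mangoldt_series (Complex \<sigma> t) * cis (t * l))"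
proof -
  have "Re (mangoldt n * of_nat n powr - Complex \<sigma> t * cis (t * l)) =
      mangoldt n * real n powr - \<sigma> * cos (t * (ln (real n) - l))" for n
  proof (cases "n = 0")
    case False
    have "mangoldt n * of_nat n powr - Complex \<sigma> t * cis (t * l) =
        of_real (mangoldt n * real n powr - \<sigma>) * cis (t * l - t * ln (real n))"
      using False by (simp add: of_nat_powr_Complex mult_ac cis_mult)
    also have "Re \<dots> = mangoldt n * real n powr - \<sigma> * cos (- (t * (ln (real n) - l)))"
      by (simp add: algebra_simps)
    finally show ?thesis by simp
  qed auto
  then show ?thesis
    using sums_Re[OF sums_mult2[OF mangoldt_series_sums[of "Complex \<sigma> t"], of "cis (t * l)"]] assms
    by simp
qed

lemma norm_mangoldt_series_le:
  assumes "1 < c" "c \<le> Re s"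
  shows "norm (mangoldt_series s) \<le> (\<Sum>n. mangoldt n * real n powr - c)"
proof -
  have "norm (mangoldt_series s) \<le> (\<Sum>n. mangoldt n * real n powr - Re s)"
    unfolding mangoldt_series_def
    using summable_norm[OF summable_norm_mangoldt_series[of s]] assms by (simp add: norm_mangoldt_powr)
  also have "\<dots> \<le> (\<Sum>n. mangoldt n * real n powr - c)"
  proof (intro suminf_le summable_mangoldt_powr)
    show "mangoldt n * real n powr - Re s \<le> mangoldt n * real n powr - c" for n
    proof (cases "n = 0")
      case False
      then show ?thesis
        using assms by (intro mult_left_mono powr_mono) (auto simp: mangoldt_nonneg)
    qed auto
  qed (use assms in auto)
  finally show ?thesis .
qed

text \<open>3 + 4 cos x + cos 2x = 2 (1 + cos x)^2 >= 0 with x = t ln n, summed with nonnegative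
  weights.\<close>

lemma mangoldt_series_341:
  assumes "\<sigma> > 1"
  shows "3 * Re (mangoldt_series (Complex \<sigma> 0)) + 4 * Re (mangoldt_series (Complex \<sigma> t))
    + Re (mangoldt_series (Complex \<sigma> (2 * t))) \<ge> 0"
proof -
  have sums: "(\<lambda>n. 3 * (mangoldt n * real n powr - \<sigma> * cos (0 * (ln (real n) - 0)))
        + 4 * (mangoldt n * real n powr - \<sigma> * cos (t * (ln (real n) - 0)))
        + mangoldt n * real n powr - \<sigma> * cos (2 * t * (ln (real n) - 0)))
     sums (3 * Re (mangoldt_series (Complex \<sigma> 0) * cis (0 * 0))
       + 4 * Re (mangoldt_series (Complex \<sigma> t) * cis (t * 0))
       + Re (mangoldt_series (Complex \<sigma> (2 * t)) * cis (2 * t * 0)))"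
    by (intro sums_add sums_mult mangoldt_series_cos_sums assms)
  have nonneg: "3 * (mangoldt n * real n powr - \<sigma> * cos (0 * (ln (real n) - 0)))
        + 4 * (mangoldt n * real n powr - \<sigma> * cos (t * (ln (real n) - 0)))
        + mangoldt n * real n powr - \<sigma> * cos (2 * t * (ln (real n) - 0)) \<ge> 0" for n
  proof -
    define c where "c = cos (t * ln (real n))"
    have "cos (2 * t * ln (real n)) = 2 * c\<^sup>2 - 1"
      unfolding c_def by (metis cos_double_cos mult.assoc)
    moreover have "3 * (A * 1) + 4 * (A * c) + A * (2 * c\<^sup>2 - 1) = A * (2 * (1 + c)\<^sup>2)" for A :: real
      by (simp add: power2_eq_square algebra_simps)
    ultimately have "3 * (mangoldt n * real n powr - \<sigma> * cos (0 * (ln (real n) - 0)))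
        + 4 * (mangoldt n * real n powr - \<sigma> * cos (t * (ln (real n) - 0)))
        + mangoldt n * real n powr - \<sigma> * cos (2 * t * (ln (real n) - 0))
      = mangoldt n * real n powr - \<sigma> * (2 * (1 + c)\<^sup>2)"
      by (simp only: diff_zero mult_zero_left cos_zero flip: c_def)
    then show ?thesis by (simp add: mangoldt_nonneg)
  qed
  from sums_le[OF nonneg sums_zero sums] show ?thesis by simp
qed

lemma mangoldt_series_eq:
  assumes "Re s > 1" "reg_zeta s \<noteq> 0"
  shows "mangoldt_series s = 1 / (s - 1) - deriv reg_zeta s / reg_zeta s"
  using deriv_reg_zeta[OF assms(1)] assms(2) by (simp add: field_simps)

text \<open>In 1 / (s - 1) - \<open>reg_zeta\<close>'/\<open>reg_zeta\<close> the first part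
  contributes 1 at s = 1 only, and a zero of order m contributes -m.\<close>

lemma mangoldt_series_residue:
  assumes s: "Re s \<ge> 1"
  obtains m :: nat where "reg_zeta s = 0 \<longleftrightarrow> m > 0"
    "((\<lambda>\<eta>. of_real \<eta> * mangoldt_series (s + of_real \<eta>)) \<longlongrightarrow> (if s = 1 then 1 else 0) - of_nat m) (at_right 0)"
proof -
  have "connected {s :: complex. Re s > 0}"
    by (intro convex_connected convex_halfspace_Re_gt)
  from logarithmic_derivative_residue[OF holomorphic_reg_zeta open_Re_gt this, of s 1]
  obtain m :: nat where m: "reg_zeta s = 0 \<longleftrightarrow> m > 0"
    and lim: "((\<lambda>\<eta>. of_real \<eta> * (deriv reg_zeta (s + of_real \<eta>) / reg_zeta (s + of_real \<eta>))) \<longlongrightarrow> of_nat m) (at_right 0)"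
    and nz: "\<forall>\<^sub>F \<eta> in at_right 0. reg_zeta (s + of_real \<eta>) \<noteq> 0"
    using s by (auto simp: reg_zeta_1)
  have "((\<lambda>\<eta>. of_real \<eta> * (1 / (s + of_real \<eta> - 1))) \<longlongrightarrow> (if s = 1 then 1 else 0)) (at_right 0)"
  proof (cases "s = 1")
    case True
    have "\<forall>\<^sub>F \<eta> in at_right 0. (1 :: complex) = of_real \<eta> * (1 / (s + of_real \<eta> - 1))"
      using eventually_at_right_less[of "0 :: real"] by eventually_elim (simp add: True)
    then show ?thesis using True by (auto intro: Lim_transform_eventually[OF tendsto_const])
  next
    case False
    then have "((\<lambda>\<eta>. of_real \<eta> * (1 / (s + of_real \<eta> - 1))) \<longlongrightarrow> of_real 0 * (1 / (s + of_real 0 - 1))) (at_right 0)"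
      by (intro tendsto_intros) auto
    then show ?thesis using False by simp
  qed
  from tendsto_diff[OF this lim]
  have "((\<lambda>\<eta>. of_real \<eta> * mangoldt_series (s + of_real \<eta>)) \<longlongrightarrow> (if s = 1 then 1 else 0) - of_nat m) (at_right 0)"
  proof (rule Lim_transform_eventually)
    show "\<forall>\<^sub>F \<eta> in at_right 0. of_real \<eta> * (1 / (s + of_real \<eta> - 1))
        - of_real \<eta> * (deriv reg_zeta (s + of_real \<eta>) / reg_zeta (s + of_real \<eta>))
        = of_real \<eta> * mangoldt_series (s + of_real \<eta>)"
      using nz eventually_at_right_less[of "0 :: real"]
    proof eventually_elim
      case (elim \<eta>)
      then show ?case using s by (simp add: mangoldt_series_eq right_diff_distrib)
    qed
  qed
  then show ?thesis using that m by blast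
qed

text \<open>
  For \<open>Re s > 1\<close> a zero would give \<open>mangoldt_series\<close>, which is bounded there, a pole;
  for \<open>Re s = 1\<close> this is the \<open>3-4-1\<close> argument.
\<close>

theorem reg_zeta_nonzero:
  assumes s: "Re s \<ge> 1"
  shows "reg_zeta s \<noteq> 0"
proof (cases "Re s > 1")
  case True
  obtain m :: nat where m: "reg_zeta s = 0 \<longleftrightarrow> m > 0"
    and lim: "((\<lambda>\<eta>. of_real \<eta> * mangoldt_series (s + of_real \<eta>)) \<longlongrightarrow> (if s = 1 then 1 else 0) - of_nat m) (at_right 0)"
    using mangoldt_series_residue[OF s] .
  define B where "B = (\<Sum>n. mangoldt n * real n powr - Re s)"
  have "((\<lambda>\<eta>. of_real \<eta> * mangoldt_series (s + of_real \<eta>)) \<longlongrightarrow> 0) (at_right 0)"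
  proof (rule Lim_null_comparison)
    show "\<forall>\<^sub>F \<eta> in at_right 0. norm (of_real \<eta> * mangoldt_series (s + of_real \<eta>)) \<le> \<eta> * B"
      using eventually_at_right_less[of "0 :: real"]
    proof eventually_elim
      case (elim \<eta>)
      then show ?case
        using norm_mangoldt_series_le[of "Re s" "s + of_real \<eta>"] True
        by (auto simp: norm_mult B_def intro!: mult_left_mono)
    qed
    show "((\<lambda>\<eta>. \<eta> * B) \<longlongrightarrow> 0) (at_right 0)"
      by (auto intro!: tendsto_eq_intros)
  qed
  with lim have "(if s = 1 then 1 else 0) - of_nat m = (0 :: complex)"
    by (intro tendsto_unique) auto
  moreover have "s \<noteq> 1" using True by auto
  ultimately have "m = 0" by simp
  with m show ?thesis by simp
next
  case False
  define t where "t = Im s"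
  have s_eq: "s = Complex 1 t" using s False by (simp add: complex_eq_iff t_def)
  show ?thesis
  proof (cases "t = 0")
    case True
    then have "s = 1" by (simp add: s_eq complex_eq_iff)
    then show ?thesis by (simp add: reg_zeta_1)
  next
    case False
    have add: "Complex 1 u + of_real \<eta> = Complex (1 + \<eta>) u" for u \<eta> by (simp add: complex_eq_iff)
    have res: "\<exists>m :: nat. (reg_zeta (Complex 1 u) = 0 \<longleftrightarrow> m > 0) \<and>
        ((\<lambda>\<eta>. \<eta> * Re (mangoldt_series (Complex (1 + \<eta>) u))) \<longlongrightarrow> (if u = 0 then 1 else 0) - real m) (at_right 0)" for u
    proof -
      obtain m :: nat where m: "reg_zeta (Complex 1 u) = 0 \<longleftrightarrow> m > 0"
        and lim: "((\<lambda>\<eta>. of_real \<eta> * mangoldt_series (Complex 1 u + of_real \<eta>)) \<longlongrightarrow>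
          (if Complex 1 u = 1 then 1 else 0) - of_nat m) (at_right 0)"
        using mangoldt_series_residue[of "Complex 1 u"] by auto
      have "Complex 1 u = 1 \<longleftrightarrow> u = 0" by (simp add: complex_eq_iff)
      with tendsto_Re[OF lim] m show ?thesis by (auto simp: add intro!: exI[of _ m])
    qed
    obtain m0 where m0: "reg_zeta (Complex 1 0) = 0 \<longleftrightarrow> m0 > 0"
      "((\<lambda>\<eta>. \<eta> * Re (mangoldt_series (Complex (1 + \<eta>) 0))) \<longlongrightarrow> 1 - real m0) (at_right 0)"
      using res[of 0] by auto
    have "Complex 1 0 = 1" by (simp add: complex_eq_iff)
    then have [simp]: "m0 = 0" using m0(1) by (simp add: reg_zeta_1)
    obtain m1 where m1: "reg_zeta (Complex 1 t) = 0 \<longleftrightarrow> m1 > 0"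
      "((\<lambda>\<eta>. \<eta> * Re (mangoldt_series (Complex (1 + \<eta>) t))) \<longlongrightarrow> - real m1) (at_right 0)"
      using res[of t] False by auto
    obtain m2 where m2:
      "((\<lambda>\<eta>. \<eta> * Re (mangoldt_series (Complex (1 + \<eta>) (2 * t)))) \<longlongrightarrow> - real m2) (at_right 0)"
      using res[of "2 * t"] False by auto
    have "((\<lambda>\<eta>. 3 * (\<eta> * Re (mangoldt_series (Complex (1 + \<eta>) 0)))
        + 4 * (\<eta> * Re (mangoldt_series (Complex (1 + \<eta>) t)))
        + \<eta> * Re (mangoldt_series (Complex (1 + \<eta>) (2 * t)))) \<longlongrightarrow> 3 * (1 - real m0) + 4 * (- real m1) + - real m2)
      (at_right 0)"
      by (intro tendsto_add tendsto_mult tendsto_const m0 m1 m2)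
    moreover have "\<forall>\<^sub>F \<eta> in at_right 0. 3 * (\<eta> * Re (mangoldt_series (Complex (1 + \<eta>) 0)))
        + 4 * (\<eta> * Re (mangoldt_series (Complex (1 + \<eta>) t)))
        + \<eta> * Re (mangoldt_series (Complex (1 + \<eta>) (2 * t))) \<ge> 0"
      using eventually_at_right_less[of "0 :: real"]
    proof eventually_elim
      case (elim \<eta>)
      then have "0 \<le> \<eta> * (3 * Re (mangoldt_series (Complex (1 + \<eta>) 0))
        + 4 * Re (mangoldt_series (Complex (1 + \<eta>) t)) + Re (mangoldt_series (Complex (1 + \<eta>) (2 * t))))"
        using mangoldt_series_341[of "1 + \<eta>" t] by (intro mult_nonneg_nonneg) auto
      then show ?case by (simp add: algebra_simps)
    qed
    \<comment> \<open>Since \<open>m0\<close> = 0, this says 3 - 4 \<open>m1\<close> -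
      \<open>m2\<close> >= 0, which a zero of order \<open>m1\<close> >= 1 would violate.\<close>
    ultimately have "3 * (1 - real m0) + 4 * (- real m1) + - real m2 \<ge> 0"
      by (intro tendsto_lowerbound) auto
    then have "m1 = 0" by simp
    then show ?thesis using m1(1) by (simp add: s_eq)
  qed
qed

section \<open>Fejer smoothing\<close>

text \<open>
  Half the Fourier transform of the triangle function on \<open>[-R, R]\<close>, so nonnegative.
\<close>

definition fejer :: "real \<Rightarrow> real \<Rightarrow> real" where
  "fejer R u = (if u = 0 then R / 2 else (1 - cos (R * u)) / (R * u\<^sup>2))"

lemma fejer_has_integral:
  assumes R: "R > 0"
  shows "((\<lambda>t. (1 - t / R) * cos (t * u)) has_integral fejer R u) {0..R}"
proof (cases "u = 0")
  case True
  have "((\<lambda>t. 1 - t / R) has_integral (R - R\<^sup>2 / (2 * R)) - (0 - 0\<^sup>2 / (2 * R))) {0..R}"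
  proof (rule fundamental_theorem_of_calculus)
    fix t
    have "((\<lambda>t. t - t\<^sup>2 / (2 * R)) has_real_derivative 1 - t / R) (at t within {0..R})"
      using R by (auto intro!: derivative_eq_intros)
    then show "((\<lambda>t. t - t\<^sup>2 / (2 * R)) has_vector_derivative 1 - t / R) (at t within {0..R})"
      by (simp add: has_real_derivative_iff_has_vector_derivative)
  qed (use R in simp)
  moreover have "R - R\<^sup>2 / (2 * R) = R / 2" using R by (simp add: power2_eq_square field_simps)
  ultimately show ?thesis using True by (simp add: fejer_def)
next
  case False
  define F where "F = (\<lambda>t. (1 - t / R) * sin (t * u) / u - cos (t * u) / (R * u\<^sup>2))"
  have "((\<lambda>t. (1 - t / R) * cos (t * u)) has_integral F R - F 0) {0..R}"
  proof (rule fundamental_theorem_of_calculus)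
    fix t
    have "(F has_real_derivative ((0 - 1 / R) * sin (t * u) + (1 - t / R) * (cos (t * u) * u)) / u
        - (- sin (t * u) * u) / (R * u\<^sup>2)) (at t within {0..R})"
      unfolding F_def using R False by (auto intro!: derivative_eq_intros)
    also have "((0 - 1 / R) * sin (t * u) + (1 - t / R) * (cos (t * u) * u)) / u
        - (- sin (t * u) * u) / (R * u\<^sup>2) = (1 - t / R) * cos (t * u)"
      using R False by (simp add: divide_simps power2_eq_square)
    finally show "(F has_vector_derivative (1 - t / R) * cos (t * u)) (at t within {0..R})"
      by (simp add: has_real_derivative_iff_has_vector_derivative)
  qed (use R in simp)
  moreover have "F R - F 0 = fejer R u"
    using R False by (simp add: F_def fejer_def diff_divide_distrib)
  ultimately show ?thesis by simp
qed

lemma fejer_nonneg: "R > 0 \<Longrightarrow> fejer R u \<ge> 0"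
  by (simp add: fejer_def)

definition mangoldt_smooth :: "real \<Rightarrow> real \<Rightarrow> real \<Rightarrow> nat \<Rightarrow> real" where
  "mangoldt_smooth R \<sigma> l n = mangoldt n * real n powr - \<sigma> * fejer R (ln (real n) - l)"

text \<open>\<open>fejer\<close> is an integral of cosines over [0, R], so the cosine series can be
  integrated term by term; for fixed \<sigma> > 1 it converges uniformly, as the triangle weight and
  the cosine are at most 1 in modulus.\<close>

lemma mangoldt_smooth_sums:
  assumes R: "R > 0" and \<sigma>: "\<sigma> > 1"
  shows "mangoldt_smooth R \<sigma> l sums
    integral {0..R} (\<lambda>t. (1 - t / R) * Re (mangoldt_series (Complex \<sigma> t) * cis (t * l)))"
proof -
  define f where "f = (\<lambda>n t. (1 - t / R) * (mangoldt n * real n powr - \<sigma> * cos (t * (ln (real n) - l))))"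
  have "norm (f n t) \<le> mangoldt n * real n powr - \<sigma>" if "t \<in> {0..R}" for n t
  proof -
    have "\<bar>1 - t / R\<bar> \<le> 1" using that R by (auto simp: abs_le_iff field_simps)
    moreover have "norm (mangoldt n * real n powr - \<sigma> * cos (t * (ln (real n) - l))) \<le> mangoldt n * real n powr - \<sigma>"
      by (simp add: abs_mult mult_left_le mangoldt_nonneg)
    ultimately have "norm (f n t) \<le> 1 * (mangoldt n * real n powr - \<sigma>)"
      unfolding f_def norm_mult[of "1 - t / R"] by (intro mult_mono) auto
    then show ?thesis by simp
  qed
  from Weierstrass_m_test[OF this summable_mangoldt_powr[OF \<sigma>]]
  have unif: "uniform_limit {0..R} (\<lambda>n t. \<Sum>i<n. f i t) (\<lambda>t. \<Sum>i. f i t) sequentially" .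
  have cont: "continuous_on {0..R} (\<lambda>t. \<Sum>i<n. f i t)" for n
    unfolding f_def using R by (intro continuous_intros) auto
  obtain I J where IJ: "\<And>n. ((\<lambda>t. \<Sum>i<n. f i t) has_integral I n) {0..R}"
    "((\<lambda>t. \<Sum>i. f i t) has_integral J) {0..R}" "I \<longlonglongrightarrow> J"
    by (rule uniform_limit_integral[OF unif cont sequentially_bot]) blast
  have "(f i has_integral mangoldt_smooth R \<sigma> l i) {0..R}" for i
    using has_integral_mult_right[OF fejer_has_integral[OF R], of "mangoldt i * real i powr - \<sigma>" "ln (real i) - l"]
    unfolding f_def mangoldt_smooth_def by (simp add: mult_ac)
  then have "((\<lambda>t. \<Sum>i<n. f i t) has_integral (\<Sum>i<n. mangoldt_smooth R \<sigma> l i)) {0..R}" for n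
    by (intro has_integral_sum) auto
  then have "I = (\<lambda>n. \<Sum>i<n. mangoldt_smooth R \<sigma> l i)"
    using IJ(1) by (intro ext has_integral_unique)
  moreover have "(\<Sum>i. f i t) = (1 - t / R) * Re (mangoldt_series (Complex \<sigma> t) * cis (t * l))" for t
    unfolding f_def using sums_mult[OF mangoldt_series_cos_sums[OF \<sigma>]] by (simp add: sums_iff)
  ultimately show ?thesis using IJ(2,3) by (simp add: sums_def integral_unique)
qed

text \<open>One integration by parts gains a factor 1/l, which gives the explicit bound C / l for a
  continuously differentiable q.\<close>

lemma riemann_lebesgue:
  fixes q :: "real \<Rightarrow> complex"
  assumes R: "R > 0"
    and q: "\<And>t. t \<in> {0..R} \<Longrightarrow> (q has_vector_derivative q' t) (at t within {0..R})"
    and q': "continuous_on {0..R} q'"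
  shows "((\<lambda>l. integral {0..R} (\<lambda>t. q t * cis (t * l))) \<longlongrightarrow> 0) at_top"
proof -
  have qc: "continuous_on {0..R} q"
    unfolding continuous_on_eq_continuous_within
    using q has_vector_derivative_continuous by blast
  have "bounded (q' ` {0..R})" by (intro compact_imp_bounded compact_continuous_image q') auto
  then obtain B where bound: "\<And>t. t \<in> {0..R} \<Longrightarrow> norm (q' t) \<le> B"
    unfolding bounded_iff by (metis imageI)
  define C where "C = norm (q R) + norm (q 0) + B * R"
  have cisc: "continuous_on {0..R} (\<lambda>t. cis (t * l))" for l
    by (simp add: cis_conv_exp continuous_intros)
  have "norm (integral {0..R} (\<lambda>t. q t * cis (t * l))) \<le> C / l" if l: "l > 0" for l
  proof -
    have der: "((\<lambda>t. q t * (cis (t * l) / (\<i> * of_real l))) has_vector_derivative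
        q t * cis (t * l) + q' t * (cis (t * l) / (\<i> * of_real l))) (at t within {0..R})"
      if t: "t \<in> {0..R}" for t
    proof (rule has_vector_derivative_mult[OF q[OF t]])
      have eq: "(\<lambda>t. cis (t * l) / (\<i> * of_real l)) = (\<lambda>t. Complex (sin (t * l) / l) (- cos (t * l) / l))"
        using l by (auto simp: fun_eq_iff complex_eq_iff Re_divide Im_divide power2_eq_square)
      have "((\<lambda>t. sin (t * l) / l) has_real_derivative cos (t * l)) (at t within {0..R})"
        "((\<lambda>t. - cos (t * l) / l) has_real_derivative sin (t * l)) (at t within {0..R})"
        using l by (auto intro!: derivative_eq_intros)
      then show "((\<lambda>t. cis (t * l) / (\<i> * of_real l)) has_vector_derivative cis (t * l)) (at t within {0..R})"
        unfolding eq has_vector_derivative_complex_iff by simp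
    qed
    have A: "((\<lambda>t. q t * cis (t * l) + q' t * (cis (t * l) / (\<i> * of_real l))) has_integral
        q R * (cis (R * l) / (\<i> * of_real l)) - q 0 * (cis (0 * l) / (\<i> * of_real l))) {0..R}"
      by (rule fundamental_theorem_of_calculus) (use R der in auto)
    have B: "((\<lambda>t. q' t * (cis (t * l) / (\<i> * of_real l))) has_integral
        integral {0..R} (\<lambda>t. q' t * (cis (t * l) / (\<i> * of_real l)))) {0..R}"
      using l by (intro integrable_integral integrable_continuous_interval continuous_intros q' cisc) auto
    have "((\<lambda>t. q t * cis (t * l)) has_integral
        q R * (cis (R * l) / (\<i> * of_real l)) - q 0 * (cis (0 * l) / (\<i> * of_real l))
        - integral {0..R} (\<lambda>t. q' t * (cis (t * l) / (\<i> * of_real l)))) {0..R}"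
      using has_integral_diff[OF A B] by (simp only: add_diff_cancel_right')
    then have "integral {0..R} (\<lambda>t. q t * cis (t * l)) =
        q R * (cis (R * l) / (\<i> * of_real l)) - q 0 * (cis (0 * l) / (\<i> * of_real l))
        - integral {0..R} (\<lambda>t. q' t * (cis (t * l) / (\<i> * of_real l)))"
      by (rule integral_unique)
    also have "norm \<dots> \<le> norm (q R) / l + norm (q 0) / l + B / l * (R - 0)"
    proof (intro order_trans[OF norm_triangle_ineq4] add_mono)
      show "norm (integral {0..R} (\<lambda>t. q' t * (cis (t * l) / (\<i> * of_real l)))) \<le> B / l * (R - 0)"
      proof (rule integral_bound)
        show "norm (q' t * (cis (t * l) / (\<i> * of_real l))) \<le> B / l" if "t \<in> {0..R}" for t
          using bound[OF that] l by (simp add: norm_mult norm_divide divide_right_mono)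
      qed (use R l in \<open>auto intro!: continuous_intros q' cisc\<close>)
    qed (use l in \<open>auto simp: norm_mult norm_divide\<close>)
    also have "\<dots> = C / l" by (simp add: C_def add_divide_distrib)
    finally show ?thesis .
  qed
  then have "\<forall>\<^sub>F l in at_top. norm (integral {0..R} (\<lambda>t. q t * cis (t * l))) \<le> C / l"
    by (intro eventually_mono[OF eventually_gt_at_top[of 0]])
  moreover have "((\<lambda>l. C / l) \<longlongrightarrow> 0) at_top"
    by (intro tendsto_divide_0[OF tendsto_const] filterlim_at_top_imp_at_infinity filterlim_ident)
  ultimately show ?thesis by (rule Lim_null_comparison)
qed

section \<open>The contribution of the pole at s = 1\<close>

lemma abs_one_minus_cos_le: "\<bar>1 - cos x\<bar> \<le> \<bar>x :: real\<bar>"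
proof -
  have "1 - cos x = 2 * (sin (x / 2))\<^sup>2" using cos_double_sin[of "x / 2"] by simp
  also have "\<dots> \<le> 2 * \<bar>sin (x / 2)\<bar>"
    using power_le_one_iff[of "\<bar>sin (x / 2)\<bar>"] abs_sin_le_one[of "x / 2"]
    by (metis abs_ge_zero mult_left_le mult_left_mono power2_abs power2_eq_square zero_le_numeral)
  also have "\<dots> \<le> \<bar>x\<bar>" using abs_sin_x_le_abs_x[of "x / 2"] by simp
  finally show ?thesis using cos_le_one[of x] by simp
qed

lemma truncated_sinc_has_integral:
  assumes R: "R > 0" and l: "l > 0"
  shows "((\<lambda>t. (1 - t / R) * (sin (t * l) / t)) has_integral Si (R * l) - (1 - cos (R * l)) / (R * l)) {0..R}"
proof -
  define F where "F = (\<lambda>t. Si (t * l) + cos (t * l) / (R * l))"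
  have der: "(F has_real_derivative (if t * l = 0 then 1 else sin (t * l) / (t * l)) * l
      + (- sin (t * l) * l) / (R * l)) (at t within A)" for t A
    unfolding F_def using R l
    by (auto intro!: derivative_eq_intros DERIV_chain2[OF DERIV_Si[THEN DERIV_subset]] simp del: mult_eq_0_iff)
  have "((\<lambda>t. (1 - t / R) * (sin (t * l) / t)) has_integral F R - F 0) {0..R}"
  \<comment> \<open>At t = 0 the integrand is 0, because division by zero yields 0, whereas
    \<open>F\<close> has derivative l there. Hence the derivative is compared in the interior
    only.\<close>
  proof (rule fundamental_theorem_of_calculus_interior)
    show "continuous_on {0..R} F"
      by (rule DERIV_continuous_on[OF der])
    fix t assume "t \<in> {0<..<R}"
    then have "(if t * l = 0 then 1 else sin (t * l) / (t * l)) * l + (- sin (t * l) * l) / (R * l)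
        = (1 - t / R) * (sin (t * l) / t)"
      using l R by (simp add: field_simps)
    then show "(F has_vector_derivative (1 - t / R) * (sin (t * l) / t)) (at t)"
      using der[of t UNIV] by (simp add: has_real_derivative_iff_has_vector_derivative)
  qed (use R in simp)
  moreover have "Si 0 = 0" using Si_neg[of 0] by simp
  then have "F R - F 0 = Si (R * l) - (1 - cos (R * l)) / (R * l)"
    by (simp add: F_def diff_divide_distrib)
  ultimately show ?thesis by simp
qed

text \<open>The pole sits at the end t = 0 of the interval, where the Poisson kernels have no common
  integrable majorant. Replacing the factor (1 - t/R) cos (t l) by its value 1 at t = 0 isolates the
  singular mass, integrated exactly by arctan. What is left is amenable to dominated convergence,
  and its limit is a sine integral.\<close>

lemma pole_integral_limit:
  assumes R: "R > 0" and l: "l > 0" and \<eta>: "\<And>k. \<eta> k > 0" "\<eta> \<longlonglongrightarrow> 0"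
  shows "(\<lambda>k. integral {0..R} (\<lambda>t. (1 - t / R) * Re (cis (t * l) / Complex (\<eta> k) t)))
           \<longlonglongrightarrow> pi / 2 + (Si (R * l) - (1 - cos (R * l)) / (R * l))"
proof -
  define a where "a = (\<lambda>k t. \<eta> k / ((\<eta> k)\<^sup>2 + t\<^sup>2))"
  define b where "b = (\<lambda>k t. ((1 - t / R) * cos (t * l) - 1) * (\<eta> k / ((\<eta> k)\<^sup>2 + t\<^sup>2))
      + (1 - t / R) * sin (t * l) * (t / ((\<eta> k)\<^sup>2 + t\<^sup>2)))"
  have pos: "(\<eta> k)\<^sup>2 + t\<^sup>2 > 0" for k t using \<eta>(1)[of k] by (simp add: add_pos_nonneg)
  \<comment> \<open>\<open>a\<close> is a Poisson kernel of mass tending to \<open>\<pi>/2\<close>; \<open>b\<close> is bounded uniformly in \<open>k\<close>\<close>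
  have split: "(1 - t / R) * Re (cis (t * l) / Complex (\<eta> k) t) = a k t + b k t" for k t
  proof -
    have "Re (cis (t * l) / Complex (\<eta> k) t) = (cos (t * l) * \<eta> k + sin (t * l) * t) / ((\<eta> k)\<^sup>2 + t\<^sup>2)"
      by (simp add: Re_divide)
    moreover have "h * ((c * e + s * t) / X) = e / X + ((h * c - 1) * (e / X) + h * s * (t / X))"
      for h c e s X :: real
      by (simp add: add_divide_distrib algebra_simps)
    ultimately show ?thesis by (simp add: a_def b_def)
  qed
  have ia: "(a k has_integral arctan (R / \<eta> k) - arctan (0 / \<eta> k)) {0..R}" for k
  proof (rule fundamental_theorem_of_calculus)
    fix t
    have "((\<lambda>t. arctan (t / \<eta> k)) has_real_derivative (1 / \<eta> k) * (1 / (1 + (t / \<eta> k)\<^sup>2))) (at t within {0..R})"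
      using \<eta>(1)[of k] by (auto intro!: derivative_eq_intros simp: field_simps)
    also have "(1 / \<eta> k) * (1 / (1 + (t / \<eta> k)\<^sup>2)) = a k t"
      using \<eta>(1)[of k] pos[of k t] by (simp add: a_def power2_eq_square field_simps)
    finally show "((\<lambda>t. arctan (t / \<eta> k)) has_vector_derivative a k t) (at t within {0..R})"
      by (simp add: has_real_derivative_iff_has_vector_derivative)
  qed (use R in simp)
  have ib: "b k integrable_on {0..R}" for k
    unfolding b_def using \<eta>(1)[of k] R
    by (intro integrable_continuous_interval continuous_intros) auto
  \<comment> \<open>Both prefactors in \<open>b\<close> are O(t), with constants l + 1/R and l. They
    cancel the singularity because \<open>t * \<eta> k\<close> and t^2 are at most
    \<open>(\<eta> k)\<^sup>2 + t\<^sup>2\<close>.\<close>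
  have bound: "norm (b k t) \<le> (l + 1 / R) + l" if t: "t \<in> {0..R}" for k t
  proof -
    have t0: "0 \<le> t" "0 \<le> 1 - t / R" "1 - t / R \<le> 1" using t R by auto
    have "(1 - t / R) * cos (t * l) - 1 = (1 - t / R) * (cos (t * l) - 1) - t / R"
      by (simp add: algebra_simps)
    also have "\<bar>\<dots>\<bar> \<le> \<bar>(1 - t / R) * (cos (t * l) - 1)\<bar> + \<bar>t / R\<bar>" by (rule abs_triangle_ineq4)
    also have "\<dots> \<le> 1 * \<bar>t * l\<bar> + \<bar>t / R\<bar>"
      unfolding abs_mult[of "1 - t / R"]
      using t0 abs_one_minus_cos_le[of "t * l"]
      by (intro add_mono mult_mono) (auto simp: abs_minus_commute)
    also have "\<dots> = (l + 1 / R) * t" using t0 l R by (simp add: algebra_simps)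
    finally have 1: "\<bar>(1 - t / R) * cos (t * l) - 1\<bar> \<le> (l + 1 / R) * t" .
    have "2 * (\<eta> k * t) \<le> (\<eta> k)\<^sup>2 + t\<^sup>2" using sum_squares_bound[of "\<eta> k" t] by simp
    moreover have "0 \<le> \<eta> k * t" using t0 \<eta>(1)[of k] by simp
    ultimately have 2: "t * (\<eta> k / ((\<eta> k)\<^sup>2 + t\<^sup>2)) \<le> 1"
      using pos[of k t] by (simp add: field_simps)
    have "\<bar>((1 - t / R) * cos (t * l) - 1) * (\<eta> k / ((\<eta> k)\<^sup>2 + t\<^sup>2))\<bar>
        \<le> ((l + 1 / R) * t) * (\<eta> k / ((\<eta> k)\<^sup>2 + t\<^sup>2))"
      unfolding abs_mult using 1 \<eta>(1)[of k] pos[of k t] by (intro mult_mono) auto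
    also have "\<dots> = (l + 1 / R) * (t * (\<eta> k / ((\<eta> k)\<^sup>2 + t\<^sup>2)))" by simp
    also have "\<dots> \<le> (l + 1 / R) * 1" using 2 l R by (intro mult_left_mono) auto
    finally have 3: "\<bar>((1 - t / R) * cos (t * l) - 1) * (\<eta> k / ((\<eta> k)\<^sup>2 + t\<^sup>2))\<bar> \<le> l + 1 / R" by simp
    have "\<bar>(1 - t / R) * sin (t * l)\<bar> \<le> 1 * \<bar>t * l\<bar>"
      unfolding abs_mult[of "1 - t / R"] using t0 by (intro mult_mono abs_sin_x_le_abs_x) auto
    then have "\<bar>(1 - t / R) * sin (t * l) * (t / ((\<eta> k)\<^sup>2 + t\<^sup>2))\<bar> \<le> (t * l) * (t / ((\<eta> k)\<^sup>2 + t\<^sup>2))"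
      unfolding abs_mult[of _ "t / _"] using t0 l pos[of k t] by (intro mult_mono) auto
    also have "\<dots> = l * (t\<^sup>2 / ((\<eta> k)\<^sup>2 + t\<^sup>2))" by (simp add: power2_eq_square)
    also have "\<dots> \<le> l * 1" using l pos[of k t] by (intro mult_left_mono) (auto simp: field_simps)
    finally have 4: "\<bar>(1 - t / R) * sin (t * l) * (t / ((\<eta> k)\<^sup>2 + t\<^sup>2))\<bar> \<le> l" by simp
    show ?thesis unfolding b_def real_norm_def using 3 4 by (intro order_trans[OF abs_triangle_ineq] add_mono)
  qed
  \<comment> \<open>At t = 0 every \<open>b k t\<close> is 0, and so is the stated limit, since
    division by zero yields 0.\<close>
  have conv: "(\<lambda>k. b k t) \<longlonglongrightarrow> (1 - t / R) * (sin (t * l) / t)" if "t \<in> {0..R}" for t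
  proof (cases "t = 0")
    case False
    have "(\<lambda>k. b k t) \<longlonglongrightarrow> ((1 - t / R) * cos (t * l) - 1) * (0 / (0\<^sup>2 + t\<^sup>2))
        + (1 - t / R) * sin (t * l) * (t / (0\<^sup>2 + t\<^sup>2))"
      unfolding b_def using False by (intro tendsto_intros \<eta>(2)) auto
    moreover have "t / t\<^sup>2 = 1 / t" using False by (simp add: power2_eq_square)
    ultimately show ?thesis by simp
  qed (simp add: b_def)
  have "(\<lambda>k. integral {0..R} (b k)) \<longlonglongrightarrow> integral {0..R} (\<lambda>t. (1 - t / R) * (sin (t * l) / t))"
    by (rule dominated_convergence(2)[OF ib _ bound conv]) auto
  moreover have "(\<lambda>k. arctan (R / \<eta> k)) \<longlonglongrightarrow> pi / 2"
  proof (rule filterlim_compose[OF tendsto_arctan_at_top])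
    have "filterlim \<eta> (at_right 0) sequentially"
      using \<eta> by (auto simp: filterlim_at less_imp_neq[symmetric])
    then have "filterlim (\<lambda>k. inverse (\<eta> k)) at_top sequentially"
      by (rule filterlim_compose[OF filterlim_inverse_at_top_right])
    then show "filterlim (\<lambda>k. R / \<eta> k) at_top sequentially"
      unfolding divide_inverse by (rule filterlim_tendsto_pos_mult_at_top[OF tendsto_const R])
  qed
  ultimately have "(\<lambda>k. arctan (R / \<eta> k) + integral {0..R} (b k)) \<longlonglongrightarrow>
      pi / 2 + integral {0..R} (\<lambda>t. (1 - t / R) * (sin (t * l) / t))"
    by (rule tendsto_add[rotated])
  moreover have "integral {0..R} (\<lambda>t. (1 - t / R) * Re (cis (t * l) / Complex (\<eta> k) t))
      = arctan (R / \<eta> k) + integral {0..R} (b k)" for k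
    unfolding split using has_integral_add[OF ia integrable_integral[OF ib]] by (simp add: integral_unique)
  ultimately show ?thesis
    using truncated_sinc_has_integral[OF R l] by (simp add: integral_unique)
qed

section \<open>The part of -zeta'/zeta left after removing 1 / (s - 1), and the limit \<sigma> to
  1\<close>

definition reg_part :: "complex \<Rightarrow> complex" where
  "reg_part s = - (deriv reg_zeta s / reg_zeta s)"

text \<open>Here the nonvanishing on Re s = 1 enters. An open set around the closed half-plane makes
  \<open>reg_part\<close> continuously differentiable along the line itself, as Riemann-Lebesgue
  requires.\<close>

lemma reg_part_domain:
  obtains U where "open U" "{s. Re s \<ge> 1} \<subseteq> U" "reg_part holomorphic_on U"
proof -
  define U where "U = {s. Re s > 0} \<inter> reg_zeta -` (- {0})"
  have "open U"
    unfolding U_def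
    by (intro continuous_open_preimage holomorphic_on_imp_continuous_on holomorphic_reg_zeta open_Re_gt) auto
  moreover have "{s. Re s \<ge> 1} \<subseteq> U" using reg_zeta_nonzero by (auto simp: U_def)
  moreover have "reg_part holomorphic_on U"
  proof -
    have "reg_zeta holomorphic_on U"
      by (rule holomorphic_on_subset[OF holomorphic_reg_zeta]) (auto simp: U_def)
    then show ?thesis
      unfolding reg_part_def using \<open>open U\<close> by (intro holomorphic_intros) (auto simp: U_def)
  qed
  ultimately show ?thesis using that by blast
qed

lemma mangoldt_series_decomp:
  assumes "Re s > 1"
  shows "mangoldt_series s = 1 / (s - 1) + reg_part s"
  using mangoldt_series_eq[OF assms] reg_zeta_nonzero[of s] assms by (simp add: reg_part_def)

text \<open>This plays the role of the smoothed sum with exponent 1. The terms before the integral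
  stem from the pole, the integral from the regular part.\<close>

definition smooth_limit :: "real \<Rightarrow> real \<Rightarrow> real" where
  "smooth_limit R l = pi / 2 + (Si (R * l) - (1 - cos (R * l)) / (R * l))
     + integral {0..R} (\<lambda>t. (1 - t / R) * Re (reg_part (Complex 1 t) * cis (t * l)))"

text \<open>Joint continuity on a compact box allows \<sigma> to tend to 1 under the integral; 2 is
  the largest exponent of the sequence \<open>1 + 1 / real (Suc k)\<close>.\<close>

lemma continuous_on_reg_part_kernel:
  assumes R: "R > 0"
  shows "continuous_on ({1..2} \<times> {0..R})
    (\<lambda>(\<sigma>, t). (1 - t / R) * Re (reg_part (Complex \<sigma> t) * cis (t * l)))"
proof -
  obtain U where U: "open U" "{s. Re s \<ge> 1} \<subseteq> U" "reg_part holomorphic_on U"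
    by (rule reg_part_domain)
  have *: "continuous_on ({1..2} \<times> {0..R}) (\<lambda>x. reg_part (of_real (fst x) + \<i> * of_real (snd x)))"
    by (rule continuous_on_compose2[OF holomorphic_on_imp_continuous_on[OF U(3)]])
      (use U(2) in \<open>auto intro!: continuous_intros\<close>)
  have "continuous_on ({1..2} \<times> {0..R}) (\<lambda>x. (1 - snd x / R) *
      Re (reg_part (of_real (fst x) + \<i> * of_real (snd x)) * exp (\<i> * of_real (snd x * l))))"
    using R by (intro continuous_intros *) auto
  then show ?thesis by (simp add: split_beta Complex_eq cis_conv_exp)
qed

lemma suminf_mangoldt_smooth_limit:
  assumes R: "R > 0" and l: "l > 0"
  shows "(\<lambda>k. suminf (mangoldt_smooth R (1 + 1 / real (Suc k)) l)) \<longlonglongrightarrow> smooth_limit R l"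
proof -
  define \<eta> where "\<eta> = (\<lambda>k. 1 / real (Suc k))"
  define h where "h = (\<lambda>\<sigma> t. (1 - t / R) * Re (reg_part (Complex \<sigma> t) * cis (t * l)))"
  have \<eta>: "\<eta> k > 0" "\<eta> k \<le> 1" for k by (auto simp: \<eta>_def)
  have \<eta>_lim: "\<eta> \<longlonglongrightarrow> 0" unfolding \<eta>_def by (rule LIMSEQ_inverse_real_of_nat[unfolded inverse_eq_divide])
  have "continuous_on {1..2} (\<lambda>\<sigma>. integral (cbox 0 R) (h \<sigma>))"
    using continuous_on_reg_part_kernel[OF R, of l]
    by (intro integral_continuous_on_param) (simp add: h_def)
  then have "(\<lambda>k. integral (cbox 0 R) (h (1 + \<eta> k))) \<longlonglongrightarrow> integral (cbox 0 R) (h 1)"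
    by (rule continuous_on_tendsto_compose)
      (use \<eta> \<eta>_lim in \<open>auto intro!: tendsto_eq_intros always_eventually less_imp_le\<close>)
  then have reg: "(\<lambda>k. integral {0..R} (h (1 + \<eta> k))) \<longlonglongrightarrow> integral {0..R} (h 1)" by simp
  have eq: "suminf (mangoldt_smooth R (1 + \<eta> k) l) =
      integral {0..R} (\<lambda>t. (1 - t / R) * Re (cis (t * l) / Complex (\<eta> k) t)) + integral {0..R} (h (1 + \<eta> k))" for k
  proof -
    have int_h: "h (1 + \<eta> k) integrable_on {0..R}"
    proof (rule integrable_continuous_interval)
      have "continuous_on {0..R} (\<lambda>t. (\<lambda>(\<sigma>, t). h \<sigma> t) (1 + \<eta> k, t))"
        by (rule continuous_on_compose2[OF continuous_on_reg_part_kernel[OF R, of l, folded h_def]])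
          (use \<eta>[of k] in \<open>auto intro!: continuous_intros\<close>)
      then show "continuous_on {0..R} (h (1 + \<eta> k))" by simp
    qed
    have int_p: "(\<lambda>t. (1 - t / R) * Re (cis (t * l) / Complex (\<eta> k) t)) integrable_on {0..R}"
    proof (rule integrable_continuous_interval)
      have "of_real (\<eta> k) + \<i> * of_real t \<noteq> 0" for t
        using \<eta>(1)[of k] by (auto simp: complex_eq_iff)
      then show "continuous_on {0..R} (\<lambda>t. (1 - t / R) * Re (cis (t * l) / Complex (\<eta> k) t))"
        unfolding Complex_eq cis_conv_exp using R by (intro continuous_intros) auto
    qed
    have "(1 - t / R) * Re (mangoldt_series (Complex (1 + \<eta> k) t) * cis (t * l)) =
        (1 - t / R) * Re (cis (t * l) / Complex (\<eta> k) t) + h (1 + \<eta> k) t" for t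
    proof -
      have "Complex (1 + \<eta> k) t - 1 = Complex (\<eta> k) t" by (simp add: complex_eq_iff)
      then have "mangoldt_series (Complex (1 + \<eta> k) t) = 1 / Complex (\<eta> k) t + reg_part (Complex (1 + \<eta> k) t)"
        using mangoldt_series_decomp[of "Complex (1 + \<eta> k) t"] \<eta>[of k] by simp
      then show ?thesis by (simp add: h_def distrib_left distrib_right)
    qed
    then show ?thesis
      using mangoldt_smooth_sums[OF R, of "1 + \<eta> k" l] \<eta>[of k] integral_add[OF int_p int_h]
      by (simp add: sums_iff)
  qed
  have "(\<lambda>k. suminf (mangoldt_smooth R (1 + \<eta> k) l)) \<longlonglongrightarrow> smooth_limit R l"
    unfolding eq smooth_limit_def
    using tendsto_add[OF pole_integral_limit[OF R l \<eta>(1) \<eta>_lim] reg] by (simp add: h_def)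
  then show ?thesis by (simp add: \<eta>_def)
qed

text \<open>The Poisson mass pi/2 is already present and Si contributes another pi/2. The cosine
  quotient decays like 1/l, and the remaining integral is the real part of a Fourier integral to
  which Riemann-Lebesgue applies.\<close>

lemma smooth_limit_at_top:
  assumes R: "R > 0"
  shows "(smooth_limit R \<longlongrightarrow> pi) at_top"
proof -
  have Rl: "filterlim (\<lambda>l. R * l) at_top at_top"
    by (rule filterlim_tendsto_pos_mult_at_top[OF tendsto_const R filterlim_ident])
  have Si: "((\<lambda>l. Si (R * l)) \<longlongrightarrow> pi / 2) at_top"
    by (rule filterlim_compose[OF Si_at_top Rl])
  have "((\<lambda>x::real. (1 - cos x) / x) \<longlongrightarrow> 0) at_top"
  proof (rule Lim_null_comparison)
    show "\<forall>\<^sub>F x::real in at_top. norm ((1 - cos x) / x) \<le> 2 / x"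
      using eventually_gt_at_top[of "0 :: real"]
    proof eventually_elim
      case (elim x)
      then show ?case using cos_ge_minus_one[of x] by (simp add: divide_right_mono abs_le_iff)
    qed
    show "((\<lambda>x::real. 2 / x) \<longlongrightarrow> 0) at_top" by real_asymp
  qed
  then have cos: "((\<lambda>l. (1 - cos (R * l)) / (R * l)) \<longlongrightarrow> 0) at_top"
    by (rule filterlim_compose[OF _ Rl])
  obtain U where U: "open U" "{s. Re s \<ge> 1} \<subseteq> U" "reg_part holomorphic_on U"
    by (rule reg_part_domain)
  have in_U: "Complex 1 t \<in> U" for t using U(2) by auto
  define q where "q = (\<lambda>t. of_real (1 - t / R) * reg_part (Complex 1 t))"
  define q' where "q' = (\<lambda>t. of_real (1 - t / R) * (\<i> * deriv reg_part (Complex 1 t))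
      + of_real (- 1 / R) * reg_part (Complex 1 t))"
  have cont: "continuous_on {0..R} (\<lambda>t. f (Complex 1 t))" if "f holomorphic_on U" for f
    by (rule continuous_on_compose2[OF holomorphic_on_imp_continuous_on[OF that]])
      (use in_U in \<open>auto intro!: continuous_intros simp: Complex_eq\<close>)
  have q: "(q has_vector_derivative q' t) (at t within {0..R})" for t
  proof -
    have "((\<lambda>t. Complex 1 t) has_vector_derivative \<i>) (at t within {0..R})"
      by (auto simp: has_vector_derivative_complex_iff)
    from field_vector_diff_chain_within[OF this has_field_derivative_at_within[OF holomorphic_derivI[OF U(3,1) in_U]]]
    have "((\<lambda>t. reg_part (Complex 1 t)) has_vector_derivative \<i> * deriv reg_part (Complex 1 t)) (at t within {0..R})"
      by (simp add: o_def)
    moreover have "((\<lambda>t. complex_of_real (1 - t / R)) has_vector_derivative of_real (- 1 / R)) (at t within {0..R})"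
      using R by (intro has_vector_derivative_of_real) (auto intro!: derivative_eq_intros)
    ultimately show ?thesis unfolding q_def q'_def by (intro has_vector_derivative_mult)
  qed
  have contq: "continuous_on {0..R} q" "continuous_on {0..R} q'"
    unfolding q_def q'_def using R
    by (intro continuous_intros cont U holomorphic_deriv; simp)+
  have "((\<lambda>l. integral {0..R} (\<lambda>t. q t * cis (t * l))) \<longlongrightarrow> 0) at_top"
    by (rule riemann_lebesgue[OF R q contq(2)])
  then have "((\<lambda>l. Re (integral {0..R} (\<lambda>t. q t * cis (t * l)))) \<longlongrightarrow> Re 0) at_top"
    by (rule tendsto_Re)
  moreover have "Re (integral {0..R} (\<lambda>t. q t * cis (t * l))) =
      integral {0..R} (\<lambda>t. (1 - t / R) * Re (reg_part (Complex 1 t) * cis (t * l)))" for l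
  proof -
    have "(\<lambda>t. q t * cis (t * l)) integrable_on {0..R}"
      unfolding cis_conv_exp by (intro integrable_continuous_interval continuous_intros contq)
    from integral_linear[OF this bounded_linear_Re]
    have "Re (integral {0..R} (\<lambda>t. q t * cis (t * l))) = integral {0..R} (\<lambda>t. Re (q t * cis (t * l)))"
      by (simp add: o_def)
    moreover have "Re (q t * cis (t * l)) = (1 - t / R) * Re (reg_part (Complex 1 t) * cis (t * l))" for t
      by (simp add: q_def mult.assoc del: of_real_diff)
    ultimately show ?thesis by simp
  qed
  ultimately have reg: "((\<lambda>l. integral {0..R} (\<lambda>t. (1 - t / R) * Re (reg_part (Complex 1 t) * cis (t * l)))) \<longlongrightarrow> 0) at_top"
    by simp
  have "((\<lambda>l. smooth_limit R l) \<longlongrightarrow> pi / 2 + (pi / 2 - 0) + 0) at_top"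
    unfolding smooth_limit_def by (intro tendsto_add tendsto_diff tendsto_const Si cos reg)
  then show ?thesis by simp
qed

section \<open>Primes in short intervals\<close>

text \<open>
  The two shifts are needed since \<open>fejer 1\<close> has zeros, but \<open>fejer 1 (u - 1)\<close> and
  \<open>fejer 1 (u + 1)\<close> never vanish together.
\<close>

lemma fejer_tail_bound:
  assumes R: "R > 0" and \<epsilon>: "\<epsilon> > 0" and u: "\<bar>u\<bar> \<ge> \<epsilon>"
  shows "fejer R u \<le> (1 + 1 / \<epsilon>)\<^sup>2 / (1 - cos 1) / R * (fejer 1 (u - 1) + fejer 1 (u + 1))"
proof -
  \<comment> \<open>A common bound for the absolute values of u - 1 and u + 1, so that both shifted
    kernels get the same denominator.\<close>
  define w where "w = \<bar>u\<bar> + 1"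
  have w: "w > 0" by (simp add: w_def)
  have cos1: "1 - cos (1 :: real) > 0"
    using cos_monotone_0_pi[of 0 1] pi_gt3 by simp
  have shifted: "fejer 1 v \<ge> (1 - cos v) / w\<^sup>2" if "\<bar>v\<bar> \<le> w" for v
  proof (cases "v = 0")
    case False
    have "v\<^sup>2 \<le> w\<^sup>2" using that w by (simp add: abs_le_square_iff[symmetric])
    then show ?thesis using False w by (auto simp: fejer_def intro!: divide_left_mono)
  qed (simp add: fejer_def)
  \<comment> \<open>The right-hand side equals 2 - 2 cos u cos 1, and cos u <= 1.\<close>
  have "(1 - cos 1) * 2 \<le> (1 - cos (u - 1)) + (1 - cos (u + 1))"
  proof -
    have "cos u * cos 1 \<le> 1 * cos (1 :: real)"
      using cos_ge_zero[of 1] pi_gt3 by (intro mult_right_mono) auto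
    then show ?thesis unfolding cos_add cos_diff by (simp add: mult.commute)
  qed
  then have "(1 - cos 1) * 2 / w\<^sup>2 \<le> (1 - cos (u - 1)) / w\<^sup>2 + (1 - cos (u + 1)) / w\<^sup>2"
    unfolding add_divide_distrib[symmetric] by (rule divide_right_mono) simp
  also have "\<dots> \<le> fejer 1 (u - 1) + fejer 1 (u + 1)"
    by (intro add_mono shifted) (auto simp: w_def)
  finally have 1: "2 / w\<^sup>2 \<le> (fejer 1 (u - 1) + fejer 1 (u + 1)) / (1 - cos 1)"
    using cos1 by (simp add: field_simps)
  have u0: "u \<noteq> 0" using u \<epsilon> by auto
  \<comment> \<open>Away from 0 the summand 1 in \<open>w\<close> costs only the factor 1 +
    1/\<epsilon>, so 1/u^2 and 1/w^2 are comparable.\<close>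
  have "1 \<le> \<bar>u\<bar> / \<epsilon>" using u \<epsilon> by simp
  then have "w \<le> \<bar>u\<bar> * (1 + 1 / \<epsilon>)" by (simp add: w_def algebra_simps)
  then have "w\<^sup>2 \<le> (\<bar>u\<bar> * (1 + 1 / \<epsilon>))\<^sup>2" using w by (intro power_mono) auto
  then have "w\<^sup>2 \<le> u\<^sup>2 * (1 + 1 / \<epsilon>)\<^sup>2" by (simp add: power_mult_distrib)
  then have 2: "2 / u\<^sup>2 \<le> (1 + 1 / \<epsilon>)\<^sup>2 * (2 / w\<^sup>2)" using w u0 by (simp add: field_simps)
  have "fejer R u \<le> 2 / (R * u\<^sup>2)"
    using u0 R cos_ge_minus_one[of "R * u"] by (simp add: fejer_def divide_right_mono)
  also have "\<dots> = 2 / u\<^sup>2 / R" by simp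
  also have "\<dots> \<le> (1 + 1 / \<epsilon>)\<^sup>2 * ((fejer 1 (u - 1) + fejer 1 (u + 1)) / (1 - cos 1)) / R"
    using R 1 2 by (intro divide_right_mono order_trans[OF 2] mult_left_mono) auto
  finally show ?thesis by (simp add: mult_ac)
qed

lemma fejer_le:
  assumes R: "R > 0"
  shows "fejer R u \<le> R / 2"
proof -
  have "fejer R u \<le> fejer R 0"
    using R by (intro has_integral_le[OF fejer_has_integral[OF R, of u] fejer_has_integral[OF R, of 0]])
      (auto intro!: mult_left_le)
  then show ?thesis by (simp add: fejer_def)
qed

text \<open>In a window without primes every n that counts is p^k with k >= 2. Then p <= exp(x/2)
  and k <= 2 x for x = l + \<epsilon>, so there are few such n, each contributing at most x
  exp(\<epsilon> - l). The total has order l^2 exp(-l/2).\<close>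

lemma primepow_window_sum_le:
  assumes l: "l > \<epsilon>" "\<epsilon> > 0"
    and gap: "\<not> (\<exists>p :: nat. prime p \<and> \<bar>ln (real p) - l\<bar> < \<epsilon>)"
  defines "W \<equiv> {n :: nat. n > 0 \<and> \<bar>ln (real n) - l\<bar> < \<epsilon>}"
  shows "finite W"
    and "(\<Sum>n\<in>W. mangoldt n / real n) \<le> 2 * (l + \<epsilon>)\<^sup>2 * exp ((l + \<epsilon>) / 2) * exp (\<epsilon> - l)"
proof -
  define x where "x = l + \<epsilon>"
  have x: "x > 0" using l by (simp add: x_def)
  have ln_W: "ln (real n) < x" "ln (real n) > l - \<epsilon>" "n > 0" if "n \<in> W" for n
    using that by (auto simp: W_def x_def abs_less_iff)
  show fin: "finite W"
  proof (rule finite_subset)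
    show "W \<subseteq> {..nat \<lceil>exp x\<rceil>}"
    proof
      fix n assume n: "n \<in> W"
      have "real n = exp (ln (real n))" using ln_W[OF n] by simp
      also have "\<dots> \<le> exp x" using ln_W[OF n] by (simp del: exp_ln)
      finally show "n \<in> {..nat \<lceil>exp x\<rceil>}" by (simp add: le_nat_iff) linarith
    qed
  qed auto
  define V where "V = {n \<in> W. mangoldt n \<noteq> (0 :: real)}"
  define A B where "A = {1..nat \<lfloor>exp (x / 2)\<rfloor>}" and "B = {1..nat \<lfloor>2 * x\<rfloor>}"
  have "V \<subseteq> (\<lambda>(p, k). p ^ k) ` (A \<times> B)"
  proof
    fix n assume n: "n \<in> V"
    then have "primepow n" by (auto simp: V_def mangoldt_def split: if_splits)
    then obtain p k where pk: "prime p" "k > 0" "n = p ^ k" by (auto simp: primepow_def)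
    have nW: "n \<in> W" using n by (simp add: V_def)
    have "k \<noteq> 1" using gap nW pk by (auto simp: W_def)
    then have k: "k \<ge> 2" using pk by simp
    have p2: "p \<ge> 2" using prime_ge_2_nat[OF pk(1)] .
    have ln_n: "ln (real n) = real k * ln (real p)" using p2 pk by (simp add: ln_realpow)
    have "ln 2 \<le> ln (real p)" using p2 by simp
    then have ln_p: "ln (real p) \<ge> 1 / 2" using ln2_ge_two_thirds by linarith
    \<comment> \<open>This is k/2 <= k ln p = ln n < x.\<close>
    have "real k * (1 / 2) \<le> real k * ln (real p)" using ln_p by (intro mult_left_mono) auto
    then have "real k \<le> 2 * x" using ln_W[OF nW] ln_n by linarith
    then have "k \<in> B" using pk by (simp add: B_def le_nat_iff le_floor_iff Suc_le_eq)
    have "2 * ln (real p) \<le> real k * ln (real p)" using k ln_p by (intro mult_right_mono) auto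
    then have "ln (real p) \<le> x / 2" using ln_W[OF nW] ln_n by linarith
    then have "exp (ln (real p)) \<le> exp (x / 2)" by (subst exp_le_cancel_iff)
    then have "real p \<le> exp (x / 2)" using p2 by simp
    then have "p \<in> A" using p2 by (simp add: A_def le_nat_iff le_floor_iff)
    with \<open>k \<in> B\<close> pk(3) show "n \<in> (\<lambda>(p, k). p ^ k) ` (A \<times> B)" by auto
  qed
  then have "card V \<le> card ((\<lambda>(p, k). p ^ k) ` (A \<times> B))"
    by (intro card_mono) (auto simp: A_def B_def)
  also have "\<dots> \<le> card (A \<times> B)" by (rule card_image_le) (auto simp: A_def B_def)
  finally have "real (card V) \<le> real (card A) * real (card B)"
    by (simp add: card_cartesian_product flip: of_nat_mult)
  also have "\<dots> \<le> exp (x / 2) * (2 * x)"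
  proof (intro mult_mono)
    show "real (card A) \<le> exp (x / 2)" unfolding A_def by (simp add: of_nat_floor)
    show "real (card B) \<le> 2 * x" unfolding B_def using x by (simp add: of_nat_floor)
  qed auto
  finally have card: "real (card V) \<le> exp (x / 2) * (2 * x)" .
  have "(\<Sum>n\<in>W. mangoldt n / real n) = (\<Sum>n\<in>V. mangoldt n / real n)"
    using fin by (intro sum.mono_neutral_right) (auto simp: V_def)
  also have "\<dots> \<le> real (card V) * (x * exp (\<epsilon> - l))"
  proof (rule sum_bounded_above)
    fix n assume "n \<in> V"
    then have n: "n \<in> W" by (simp add: V_def)
    have "mangoldt n \<le> x" using mangoldt_le[of n] ln_W[OF n] by simp
    moreover have "1 / real n \<le> exp (\<epsilon> - l)"
    proof -
      have "1 / real n = exp (- ln (real n))" using ln_W[OF n] by (simp add: exp_minus divide_inverse)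
      also have "\<dots> \<le> exp (\<epsilon> - l)" using ln_W[OF n] by (subst exp_le_cancel_iff) linarith
      finally show ?thesis .
    qed
    ultimately have "mangoldt n * (1 / real n) \<le> x * exp (\<epsilon> - l)"
      using x by (intro mult_mono) auto
    then show "mangoldt n / real n \<le> x * exp (\<epsilon> - l)" by simp
  qed
  also have "\<dots> \<le> exp (x / 2) * (2 * x) * (x * exp (\<epsilon> - l))"
    using card x by (intro mult_right_mono) auto
  finally show "(\<Sum>n\<in>W. mangoldt n / real n) \<le> 2 * (l + \<epsilon>)\<^sup>2 * exp ((l + \<epsilon>) / 2) * exp (\<epsilon> - l)"
    by (simp add: x_def power2_eq_square mult_ac)
qed

theorem eventually_prime_near:
  assumes \<epsilon>: "\<epsilon> > 0"
  shows "\<forall>\<^sub>F l in at_top. \<exists>p :: nat. prime p \<and> \<bar>ln (real p) - l\<bar> < \<epsilon>"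
proof -
  define K where "K = (1 + 1 / \<epsilon>)\<^sup>2 / (1 - cos 1)"
  have "1 - cos (1 :: real) > 0"
    using cos_monotone_0_pi[of 0 1] pi_gt3 by simp
  moreover have "1 + 1 / \<epsilon> > 0" using \<epsilon> by (simp add: add_pos_pos)
  ultimately have K: "K > 0" unfolding K_def by (intro divide_pos_pos zero_less_power)
  \<comment> \<open>Each of the two shifted sums tends to pi, so the tail is asymptotically at most
    (K/R) 2 pi = pi/2, which is less than pi.\<close>
  define R where "R = 4 * K"
  have R: "R > 0" "K / R = 1 / 4" using K by (auto simp: R_def)
  define Q where "Q = (\<lambda>l. R / 2 * (2 * (l + \<epsilon>)\<^sup>2 * exp ((l + \<epsilon>) / 2) * exp (\<epsilon> - l)))"
  have main: "smooth_limit R l \<le> K / R * (smooth_limit 1 (l + 1) + smooth_limit 1 (l - 1)) + Q l"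
    \<comment> \<open>The bound l > 1 keeps the shifted centre l - 1 positive, as the limit for
      \<sigma> to 1 demands.\<close>
    if l: "l > \<epsilon>" "l > 1" and gap: "\<not> (\<exists>p :: nat. prime p \<and> \<bar>ln (real p) - l\<bar> < \<epsilon>)" for l
  proof (rule LIMSEQ_le)
    define W where "W = {n :: nat. n > 0 \<and> \<bar>ln (real n) - l\<bar> < \<epsilon>}"
    show "(\<lambda>k. suminf (mangoldt_smooth R (1 + 1 / real (Suc k)) l)) \<longlonglongrightarrow> smooth_limit R l"
      using R l \<epsilon> by (intro suminf_mangoldt_smooth_limit) auto
    show "(\<lambda>k. K / R * (suminf (mangoldt_smooth 1 (1 + 1 / real (Suc k)) (l + 1))
        + suminf (mangoldt_smooth 1 (1 + 1 / real (Suc k)) (l - 1))) + Q l)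
      \<longlonglongrightarrow> K / R * (smooth_limit 1 (l + 1) + smooth_limit 1 (l - 1)) + Q l"
      using l by (intro tendsto_intros suminf_mangoldt_smooth_limit) auto
    have "suminf (mangoldt_smooth R \<sigma> l) \<le> K / R * (suminf (mangoldt_smooth 1 \<sigma> (l + 1))
        + suminf (mangoldt_smooth 1 \<sigma> (l - 1))) + Q l" if \<sigma>: "\<sigma> > 1" for \<sigma>
    proof -
      \<comment> \<open>A majorant of the terms in the window that does not depend on \<sigma>, from
        n^-\<sigma> <= 1/n and \<open>fejer\<close> <= R/2.\<close>
      define w where "w = (\<lambda>n. if n \<in> W then R / 2 * (mangoldt n / real n) else 0)"
      have summ: "summable (mangoldt_smooth r \<sigma> y)" if "r > 0" for r y
        using mangoldt_smooth_sums[OF that \<sigma>] by (simp add: sums_iff)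
      have finW: "finite W" unfolding W_def by (rule primepow_window_sum_le(1)[OF l(1) \<epsilon> gap])
      have w: "w sums (\<Sum>n\<in>W. R / 2 * (mangoldt n / real n))"
        unfolding w_def by (rule sums_If_finite_set[OF finW])
      have le: "mangoldt_smooth R \<sigma> l n \<le> K / R * (mangoldt_smooth 1 \<sigma> (l + 1) n + mangoldt_smooth 1 \<sigma> (l - 1) n) + w n" for n
      proof (cases "n = 0 \<or> n \<in> W")
        case True
        have "0 \<le> K / R * (mangoldt_smooth 1 \<sigma> (l + 1) n + mangoldt_smooth 1 \<sigma> (l - 1) n)"
          using K R by (intro mult_nonneg_nonneg add_nonneg_nonneg)
            (auto simp: mangoldt_smooth_def mangoldt_nonneg fejer_nonneg)
        moreover have "mangoldt_smooth R \<sigma> l n \<le> w n"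
        proof (cases "n = 0")
          case False
          then have n: "n \<in> W" "n > 0" using True by auto
          have "real n powr - \<sigma> \<le> real n powr - 1" using n \<sigma> by (intro powr_mono) auto
          also have "real n powr - 1 = 1 / real n" using n by (simp add: powr_minus_divide)
          finally have "real n powr - \<sigma> \<le> 1 / real n" .
          then have le: "mangoldt n * real n powr - \<sigma> \<le> mangoldt n * (1 / real n)"
            by (intro mult_left_mono mangoldt_nonneg)
          have "mangoldt n * real n powr - \<sigma> * fejer R (ln (real n) - l) \<le> mangoldt n * (1 / real n) * (R / 2)"
            by (rule mult_mono[OF le fejer_le[OF R(1)]])
              (use R in \<open>auto simp: mangoldt_nonneg fejer_nonneg\<close>)
          then show ?thesis using n by (simp add: mangoldt_smooth_def w_def mult_ac)
        qed (simp add: mangoldt_smooth_def w_def W_def)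
        ultimately show ?thesis by linarith
      next
        case False
        then have u: "\<bar>ln (real n) - l\<bar> \<ge> \<epsilon>" by (auto simp: W_def)
        have "mangoldt_smooth R \<sigma> l n \<le> mangoldt n * real n powr - \<sigma> *
            (K / R * (fejer 1 (ln (real n) - l - 1) + fejer 1 (ln (real n) - l + 1)))"
          unfolding mangoldt_smooth_def K_def
          by (intro mult_left_mono fejer_tail_bound[OF R(1) \<epsilon> u]) (auto simp: mangoldt_nonneg)
        \<comment> \<open>Shifting the argument of \<open>fejer 1\<close> by 1 down or up amounts to
          moving the centre l to l + 1 or l - 1.\<close>
        also have "\<dots> = K / R * (mangoldt_smooth 1 \<sigma> (l + 1) n + mangoldt_smooth 1 \<sigma> (l - 1) n)"
          by (simp add: mangoldt_smooth_def algebra_simps)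
        finally show ?thesis using False by (simp add: w_def)
      qed
      have "suminf (mangoldt_smooth R \<sigma> l) \<le> K / R * (suminf (mangoldt_smooth 1 \<sigma> (l + 1))
          + suminf (mangoldt_smooth 1 \<sigma> (l - 1))) + (\<Sum>n\<in>W. R / 2 * (mangoldt n / real n))"
        by (rule sums_le[OF le summable_sums[OF summ] sums_add[OF sums_mult[OF sums_add] w]])
          (use R summ in \<open>auto intro!: summable_sums\<close>)
      also have "(\<Sum>n\<in>W. R / 2 * (mangoldt n / real n)) \<le> Q l"
        unfolding Q_def sum_distrib_left[symmetric] W_def using R
        by (intro mult_left_mono primepow_window_sum_le(2)[OF l(1) \<epsilon> gap]) auto
      finally show ?thesis by simp
    qed
    then show "\<exists>N. \<forall>k\<ge>N. suminf (mangoldt_smooth R (1 + 1 / real (Suc k)) l) \<le>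
        K / R * (suminf (mangoldt_smooth 1 (1 + 1 / real (Suc k)) (l + 1))
        + suminf (mangoldt_smooth 1 (1 + 1 / real (Suc k)) (l - 1))) + Q l" by simp
  qed
  have "(Q \<longlongrightarrow> 0) at_top"
    unfolding Q_def using \<epsilon> R by real_asymp
  moreover have "filterlim (\<lambda>l :: real. l + 1) at_top at_top" "filterlim (\<lambda>l :: real. l - 1) at_top at_top"
    by real_asymp+
  ultimately have "((\<lambda>l. smooth_limit R l - (K / R * (smooth_limit 1 (l + 1) + smooth_limit 1 (l - 1)) + Q l))
      \<longlongrightarrow> pi - (K / R * (pi + pi) + 0)) at_top"
    using R by (intro tendsto_intros smooth_limit_at_top filterlim_compose[OF smooth_limit_at_top[of 1]]) auto
  moreover have "pi - (K / R * (pi + pi) + 0) > 0" unfolding R(2) using pi_gt_zero by simp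
  ultimately have "\<forall>\<^sub>F l in at_top. 0 < smooth_limit R l - (K / R * (smooth_limit 1 (l + 1) + smooth_limit 1 (l - 1)) + Q l)"
    by (rule order_tendstoD)
  then show ?thesis
    using eventually_gt_at_top[of \<epsilon>] eventually_gt_at_top[of 1]
  proof eventually_elim
    case (elim l)
    then show ?case using main[of l] by fastforce
  qed
qed

section \<open>The IDEAL-CH construction\<close>

lemma one_row_unique:
  assumes "ideal_matrix p M" "j < p"
  shows one_row_less: "one_row p M j < p" and one_row_entry: "M (one_row p M j) j = 1"
proof -
  have "\<exists>!i. i < p \<and> M i j = 1" using assms by (auto simp: ideal_matrix_def)
  from theI'[OF this] show "one_row p M j < p" "M (one_row p M j) j = 1"
    by (auto simp: one_row_def)
qed

lemma shifted_row_eq: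
  assumes "r < p" "r' < (p::nat)"
  shows "(r + (r' + p - r) mod p) mod p = r'"
proof -
  have "(r + (r' + p - r) mod p) mod p = (r + (r' + p - r)) mod p" by (simp add: mod_add_right_eq)
  also have "r + (r' + p - r) = r' + p" using assms by simp
  finally show ?thesis using assms by simp
qed

text \<open>If two columns had the same difference \<delta>, each would contribute a product 1 to
  \<open>ideal_corr p M \<delta> \<tau>\<close>, making it at least 2.\<close>

lemma one_row_difference_inj:
  assumes M: "ideal_matrix p M" and tau: "\<tau> < p" "\<tau> \<noteq> 0"
  defines "r \<equiv> one_row p M"
  shows "inj_on (\<lambda>j. (r ((j + \<tau>) mod p) + p - r j) mod p) {..<p}"
proof (rule inj_onI, rule ccontr)
  fix j j' assume j: "j \<in> {..<p}" "j' \<in> {..<p}" "j \<noteq> j'"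
    and eq: "(r ((j + \<tau>) mod p) + p - r j) mod p = (r ((j' + \<tau>) mod p) + p - r j') mod p"
  define \<delta> where "\<delta> = (r ((j + \<tau>) mod p) + p - r j) mod p"
  have p0: "p > 0" using tau by simp
  define f where "f = (\<lambda>(i, j). M ((i + \<delta>) mod p) ((j + \<tau>) mod p) * M i j)"
  have one: "f (r k, k) = 1" if "k \<in> {j, j'}" for k
  proof -
    have k: "k < p" using that j by auto
    have "(r k + \<delta>) mod p = r ((k + \<tau>) mod p)"
      using that eq k p0 shifted_row_eq[of "r k" p "r ((k + \<tau>) mod p)"] one_row_less[OF M]
      by (auto simp: \<delta>_def r_def)
    then show ?thesis using k p0 one_row_entry[OF M] by (simp add: f_def r_def)
  qed
  have "ideal_corr p M \<delta> \<tau> = (\<Sum>x\<in>{..<p} \<times> {..<p}. f x)"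
    unfolding ideal_corr_def sum.cartesian_product f_def by simp
  also have "\<dots> \<ge> (\<Sum>x\<in>{(r j, j), (r j', j')}. f x)"
    using j one_row_less[OF M] by (intro sum_mono2) (auto simp: r_def)
  also have "(\<Sum>x\<in>{(r j, j), (r j', j')}. f x) = 2"
    using j(3) one by simp
  finally have "ideal_corr p M \<delta> \<tau> \<ge> 2" .
  moreover have "ideal_corr p M \<delta> \<tau> \<le> 1"
    using M tau p0 by (auto simp: ideal_matrix_def \<delta>_def)
  ultimately show False by simp
qed

lemma one_row_difference_surj:
  assumes "ideal_matrix p M" "\<tau> < p" "\<tau> \<noteq> 0" "\<delta> < p"
  obtains j where "j < p" "(one_row p M ((j + \<tau>) mod p) + p - one_row p M j) mod p = \<delta>"
proof -
  let ?f = "\<lambda>j. (one_row p M ((j + \<tau>) mod p) + p - one_row p M j) mod p"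
  have "?f ` {..<p} = {..<p}"
    using one_row_difference_inj[OF assms(1-3)] assms(2) by (intro endo_inj_surj) auto
  then show ?thesis using that assms(4) by (metis (no_types, lifting) imageE lessThan_iff)
qed

section \<open>The set D: size of its complement and difference cover\<close>

lemma ch_Delta_le:
  assumes "p \<ge> 3"
  shows "ch_Delta p \<le> p - p div 2"
proof -
  define h where "h = p - p div 2"
  have "2 * h \<ge> p" "h \<ge> 2" using assms by (auto simp: h_def)
  then have "p \<le> h\<^sup>2" by (smt (verit) le_trans mult_le_mono1 power2_eq_square)
  then have "sqrt (real p) \<le> real h"
    by (intro real_le_lsqrt) (simp_all flip: of_nat_power)
  then show ?thesis by (simp add: ch_Delta_def h_def[symmetric] nat_le_iff ceiling_le_iff)
qed

lemma ch_Delta_pos: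
  assumes "p > 0"
  shows "ch_Delta p > 0"
  using assms by (simp add: ch_Delta_def)

lemma ch_D_less:
  assumes "p \<ge> 3" "x \<in> ch_D p"
  shows "x < p"
proof -
  have "ch_Delta p \<le> p" using ch_Delta_le[OF assms(1)] by simp
  moreover have "m * ch_Delta p - 1 < p" if "m \<le> p div ch_Delta p" for m
  proof -
    have "m * ch_Delta p \<le> p"
      using that by (meson div_times_less_eq_dividend le_trans mult_le_mono1)
    then show ?thesis using assms by linarith
  qed
  ultimately show ?thesis using assms(2) by (auto simp: ch_D_def)
qed

text \<open>Together with the choice of p this gives at least N values outside D, so that every
  channel k < N has an entry \<open>b k\<close>.\<close>

lemma card_ch_Dc_ge:
  assumes "p \<ge> 3"
  shows "int (card (ch_Dc p)) \<ge> int p - (int (ch_Delta p) + int (p div ch_Delta p) - 1)"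
proof -
  define D where "D = ch_Delta p"
  have D: "D > 0" "D \<le> p" using ch_Delta_pos[of p] ch_Delta_le[OF assms] assms by (auto simp: D_def)
  have eq: "{m * D - 1 | m. 2 \<le> m \<and> m \<le> p div D} = (\<lambda>m. m * D - 1) ` {2..p div D}" by auto
  have fin: "finite (ch_D p)" by (simp add: ch_D_def eq flip: D_def)
  have "card (ch_D p) \<le> card {0..<D} + card {m * D - 1 | m. 2 \<le> m \<and> m \<le> p div D}"
    unfolding ch_D_def D_def by (rule card_Un_le)
  also have "card {m * D - 1 | m. 2 \<le> m \<and> m \<le> p div D} \<le> card {2..p div D}"
    unfolding eq by (rule card_image_le) simp
  finally have "card (ch_D p) \<le> D + (p div D + 1 - 2)" by simp
  \<comment> \<open>Needed to read the truncated \<open>p div D + 1 - 2\<close> as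
    \<open>p div D - 1\<close>.\<close>
  moreover have "p div D \<ge> 1" using D by (simp add: div_greater_zero_iff Suc_le_eq)
  ultimately have "int (card (ch_D p)) \<le> int D + int (p div D) - 1" by linarith
  moreover have "card (ch_Dc p) \<ge> p - card (ch_D p)"
    unfolding ch_Dc_def using diff_card_le_card_Diff[OF fin, of "{0..<p}"] by simp
  ultimately show ?thesis unfolding D_def by linarith
qed

text \<open>D is a ruler: the short block supplies D - 1 - (e mod D) and the marks m D - 1 with m =
  e div D + 1 supply the multiples of D, so every e below \<open>p div D * D\<close> is a
  difference. This range exceeds p/2, and the remaining residues are negatives of covered
  ones.\<close>

lemma ch_D_difference_cover:
  assumes p: "p \<ge> 3" and "\<delta> < p"
  obtains x where "x \<in> ch_D p" "(x + \<delta>) mod p \<in> ch_D p"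
proof -
  define D where "D = ch_Delta p"
  have D: "D > 0" "D \<le> p - p div 2"
    using ch_Delta_pos[of p] ch_Delta_le[OF p] p by (auto simp: D_def)
  have cover: "\<exists>a\<in>ch_D p. a + e \<in> ch_D p" if e: "e < p div D * D" for e
  proof -
    define m where "m = e div D + 1"
    have m: "m \<le> p div D" using e D by (simp add: m_def less_mult_imp_div_less Suc_le_eq)
    have *: "m * D - 1 = (D - 1 - e mod D) + e"
    proof -
      have "m * D = D + (e - e mod D)" by (simp add: m_def minus_mod_eq_div_mult)
      moreover have "e mod D < D" "e mod D \<le> e" using D by auto
      ultimately show ?thesis by simp
    qed
    have "m * D - 1 \<in> ch_D p"
    \<comment> \<open>The mark for m = 1 is D - 1, already in the initial block; this is why the
      marks start at 2.\<close>
    proof (cases "m = 1")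
      case True
      then show ?thesis using D by (simp add: ch_D_def D_def)
    next
      case False
      then have "2 \<le> m" by (simp add: m_def)
      then show ?thesis using m unfolding ch_D_def D_def by blast
    qed
    moreover have "D - 1 - e mod D \<in> ch_D p" using D by (simp add: ch_D_def D_def)
    ultimately show ?thesis using * by metis
  qed
  have "p div D * D + p mod D = p" "p mod D < D" using D by auto
  \<comment> \<open>The remainder p mod D is below D, which is at most p/2 rounded up.\<close>
  then have big: "p div D * D > p div 2" using D(2) by linarith
  show ?thesis
  proof (cases "\<delta> < p div D * D")
    case True
    then obtain a where "a \<in> ch_D p" "a + \<delta> \<in> ch_D p" using cover by blast
    moreover from this have "(a + \<delta>) mod p = a + \<delta>" using ch_D_less[OF p] by simp
    ultimately show ?thesis using that by simp
  next
    case False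
    \<comment> \<open>The pair is traversed backwards: adding \<delta> to a + (p - \<delta>) returns
      to a modulo p.\<close>
    then have "p - \<delta> < p div D * D" using big by linarith
    then obtain a where a: "a \<in> ch_D p" "a + (p - \<delta>) \<in> ch_D p" using cover by blast
    have "(a + (p - \<delta>) + \<delta>) mod p = a" using assms(2) a(1) ch_D_less[OF p] by simp
    then show ?thesis using that[of "a + (p - \<delta>)"] a by simp
  qed
qed

text \<open>In the rotated column j the value v stands in row v + r j. Shifting by (\<delta>,
  \<tau>) leads to the value v + \<delta> - (r (j + \<tau>) - r j) modulo p. For \<tau> = 0 this is
  v + \<delta>, to be placed in D together with v; for \<tau> \<noteq> 0 a suitable j leaves v
  unchanged.\<close>

lemma ch_matrix_shift_hit:
  assumes p: "p \<ge> 3" and M: "ideal_matrix p M"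
    and b: "bij_betw b {0..<card (ch_Dc p)} (ch_Dc p)"
    and N: "N \<le> card (ch_Dc p)" and \<delta>: "\<delta> < p" and \<tau>: "\<tau> < p" and k: "k < N"
  obtains i j where "i < p" "j < p" "ch_matrix N p M b i j = k"
    "ch_matrix N p M b ((i + \<delta>) mod p) ((j + \<tau>) mod p) = k"
proof -
  define r where "r = one_row p M"
  have r: "r j < p" if "j < p" for j using one_row_less[OF M that] by (simp add: r_def)
  have tilde: "ch_tilde p M ((v + r j) mod p) j = v mod p" if "j < p" for v j
  proof -
    have "((v + r j) mod p + p - r j) mod p = ((v + r j) mod p + (p - r j)) mod p"
      using r[OF that] by simp
    also have "\<dots> = (v + r j + (p - r j)) mod p" by (rule mod_add_left_eq)
    finally show ?thesis using r[OF that] by (simp add: ch_tilde_def r_def)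
  qed
  have p0: "p > 0" using p by simp
  show ?thesis
  proof (cases "\<tau> = 0")
    case True
    obtain x where x: "x \<in> ch_D p" "(x + \<delta>) mod p \<in> ch_D p"
      using ch_D_difference_cover[OF p \<delta>] .
    have "card (ch_Dc p) \<le> p"
      using card_mono[of "{0..<p}" "ch_Dc p"] by (simp add: ch_Dc_def)
    then have kp: "k < p" using k N by simp
    have 1: "ch_tilde p M ((x + r k) mod p) k = x"
      using tilde[OF kp, of x] ch_D_less[OF p x(1)] by simp
    have "((x + r k) mod p + \<delta>) mod p = (x + r k + \<delta>) mod p"
      by (rule mod_add_left_eq)
    then have 2: "ch_tilde p M (((x + r k) mod p + \<delta>) mod p) k = (x + \<delta>) mod p"
      using tilde[OF kp, of "x + \<delta>"] by (simp add: ac_simps)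
    show ?thesis
      by (rule that[of "(x + r k) mod p" k]) (use x kp k p0 1 2 True in \<open>simp_all add: ch_matrix_def\<close>)
  next
    case False
    obtain j where j: "j < p" "(r ((j + \<tau>) mod p) + p - r j) mod p = \<delta>"
      using one_row_difference_surj[OF M \<tau> False \<delta>] unfolding r_def by blast
    define v where "v = b k"
    have kc: "k \<in> {0..<card (ch_Dc p)}" using k N by simp
    have v: "v \<in> ch_Dc p" using b kc by (auto simp: v_def bij_betw_def)
    then have v': "v < p" "v \<notin> ch_D p" by (auto simp: ch_Dc_def)
    have inv: "inv_into {0..<card (ch_Dc p)} b v = k"
      unfolding v_def using b kc by (intro inv_into_f_f) (auto simp: bij_betw_def)
    define j' where "j' = (j + \<tau>) mod p"
    have j': "j' < p" using p0 by (simp add: j'_def)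
    have "((v + r j) mod p + \<delta>) mod p = (v + (r j + (r j' + p - r j) mod p) mod p) mod p"
      using j(2) by (simp add: j'_def mod_simps add_ac)
    also have "\<dots> = (v + r j') mod p" using shifted_row_eq[OF r[OF j(1)] r[OF j']] by simp
    finally have 2: "ch_tilde p M (((v + r j) mod p + \<delta>) mod p) j' = v"
      using tilde[OF j', of v] v' by simp
    have 1: "ch_tilde p M ((v + r j) mod p) j = v" using tilde[OF j(1), of v] v' by simp
    show ?thesis
      by (rule that[of "(v + r j) mod p" j])
        (use v' j p0 1 2 k inv in \<open>simp_all add: ch_matrix_def flip: j'_def\<close>)
  qed
qed

text \<open>Write d = 2 p a + r. Column j of row i may be read in the first or the second copy. For
  r < p the first copy is used, and the shift stays within the doubled row: \<delta> = a, \<tau> =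
  r. For r >= p the second copy is used, and the shift always carries into the next row: \<delta> =
  a + 1, \<tau> = r - p. Hence the shift is the same for all (i, j).\<close>

lemma ideal_ch_seq_shift:
  assumes p: "p > 0" and d: "d < 2 * p\<^sup>2"
  obtains \<delta> \<tau> where "\<delta> < p" "\<tau> < p"
    "\<And>i j. i < p \<Longrightarrow> j < p \<Longrightarrow> \<exists>t<2 * p\<^sup>2. ideal_ch_seq N p M b t = ch_matrix N p M b i j \<and>
       ideal_ch_seq N p M b ((t + d) mod (2 * p\<^sup>2)) =
         ch_matrix N p M b ((i + \<delta>) mod p) ((j + \<tau>) mod p)"
proof -
  define a r where "a = d div (2 * p)" and "r = d mod (2 * p)"
  have d_eq: "d = 2 * p * a + r" by (simp add: a_def r_def)
  have r: "r < 2 * p" using p by (simp add: r_def)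
  have q: "2 * p\<^sup>2 = 2 * p * p" by (simp add: power2_eq_square)
  have seq: "ideal_ch_seq N p M b ((2 * p * x + y) mod (2 * p\<^sup>2)) = ch_matrix N p M b (x mod p) (y mod p)"
    if "y < 2 * p" for x y
  proof -
    have div: "(2 * p * x + y) div (2 * p) = x" using that p by simp
    have "(2 * p * x + y) mod (2 * p * p) = 2 * p * (x mod p) + y"
      using that mod_mult2_eq[of "2 * p * x + y" "2 * p" p] div by simp
    moreover have "(2 * p * (x mod p) + y) div (2 * p) = x mod p" using that p by simp
    moreover have "(2 * p * (x mod p) + y) mod p = y mod p"
      by (metis mod_mult_self4 mult.assoc mult.commute)
    ultimately show ?thesis by (simp add: ideal_ch_seq_def q)
  qed
  have less: "2 * p * i + s < 2 * p\<^sup>2" if "i < p" "s < 2 * p" for i s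
  proof -
    have "2 * p * i + s < 2 * p * (i + 1)" using that by simp
    also have "\<dots> \<le> 2 * p * p" using that by (intro mult_le_mono) auto
    finally show ?thesis by (simp add: q)
  qed
  have main: "\<exists>t<2 * p\<^sup>2. ideal_ch_seq N p M b t = ch_matrix N p M b i j \<and>
       ideal_ch_seq N p M b ((t + d) mod (2 * p\<^sup>2)) =
         ch_matrix N p M b ((i + \<delta> mod p) mod p) ((j + \<tau>) mod p)"
    if ij: "i < p" "j < p" and \<delta>\<tau>: "\<tau> < p" "s < 2 * p" "s mod p = j"
      "2 * p * i + s + d = 2 * p * (i + \<delta>) + (j + \<tau>)" for i j \<delta> \<tau> s
  proof (intro exI[of _ "2 * p * i + s"] conjI)
    show "ideal_ch_seq N p M b (2 * p * i + s) = ch_matrix N p M b i j"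
      using seq[of s i] less[of i s] ij \<delta>\<tau> by simp
    show "ideal_ch_seq N p M b ((2 * p * i + s + d) mod (2 * p\<^sup>2)) =
        ch_matrix N p M b ((i + \<delta> mod p) mod p) ((j + \<tau>) mod p)"
      using seq[of "j + \<tau>" "i + \<delta>"] \<delta>\<tau> ij by (simp add: mod_add_right_eq)
  qed (use less ij \<delta>\<tau> in auto)
  show ?thesis
  proof (cases "r < p")
    case True
    show ?thesis
    proof (rule that[of "a mod p" r])
      fix i j assume "i < p" "j < p"
      then show "\<exists>t<2 * p\<^sup>2. ideal_ch_seq N p M b t = ch_matrix N p M b i j \<and>
         ideal_ch_seq N p M b ((t + d) mod (2 * p\<^sup>2)) =
           ch_matrix N p M b ((i + a mod p) mod p) ((j + r) mod p)"
        using True by (intro main[of i j r j a]) (auto simp: d_eq algebra_simps)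
    qed (use True p in auto)
  next
    case False
    show ?thesis
    proof (rule that[of "(a + 1) mod p" "r - p"])
      fix i j assume "i < p" "j < p"
      then show "\<exists>t<2 * p\<^sup>2. ideal_ch_seq N p M b t = ch_matrix N p M b i j \<and>
         ideal_ch_seq N p M b ((t + d) mod (2 * p\<^sup>2)) =
           ch_matrix N p M b ((i + (a + 1) mod p) mod p) ((j + (r - p)) mod p)"
        using False r by (intro main[of i j "r - p" "p + j" "a + 1"]) (auto simp: d_eq algebra_simps)
    qed (use False r p in auto)
  qed
qed

theorem ideal_ch_seq_is_MACH:
  assumes N: "N \<ge> 2" and M: "ideal_matrix (ch_prime N) M"
    and b: "bij_betw b {0..<card (ch_Dc (ch_prime N))} (ch_Dc (ch_prime N))"
  shows "is_MACH N (2 * (ch_prime N)\<^sup>2) (ideal_ch_seq N (ch_prime N) M b)"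
  unfolding is_MACH_def
proof (intro allI impI)
  fix d k assume d: "d < 2 * (ch_prime N)\<^sup>2" and k: "k < N"
  define p where "p = ch_prime N"
  have p: "p \<ge> 3" using ch_prime_gt_2[OF N] by (simp add: p_def)
  have Nc: "N \<le> card (ch_Dc p)"
    using card_ch_Dc_ge[OF p] ch_prime_props(2)[of N] unfolding p_def by linarith
  obtain \<delta> \<tau> where "\<delta> < p" "\<tau> < p" and hit:
    "\<And>i j. i < p \<Longrightarrow> j < p \<Longrightarrow> \<exists>t<2 * p\<^sup>2. ideal_ch_seq N p M b t = ch_matrix N p M b i j \<and>
       ideal_ch_seq N p M b ((t + d) mod (2 * p\<^sup>2)) =
         ch_matrix N p M b ((i + \<delta>) mod p) ((j + \<tau>) mod p)"
    using ideal_ch_seq_shift[of p d N M b] d p unfolding p_def by (metis gr_zeroI not_numeral_le_zero)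
  from ch_matrix_shift_hit[OF p M[folded p_def] b[folded p_def] Nc this(1,2) k]
  show "\<exists>t<2 * (ch_prime N)\<^sup>2. ideal_ch_seq N (ch_prime N) M b t = k \<and>
      ideal_ch_seq N (ch_prime N) M b ((t + d) mod (2 * (ch_prime N)\<^sup>2)) = k"
    unfolding p_def[symmetric] using hit by metis
qed

section \<open>Asymptotics of p(N)\<close>

lemma ch_overhead_le:
  assumes "p > 0"
  shows "int (ch_Delta p) + int (p div ch_Delta p) - 1 \<ge> 0"
    and "real_of_int (int (ch_Delta p) + int (p div ch_Delta p) - 1) \<le> 2 * sqrt (real p)"
proof -
  define s where "s = sqrt (real p)"
  have s: "s > 0" "s * s = real p" using assms by (auto simp: s_def)
  have D: "s \<le> real (ch_Delta p)" "real (ch_Delta p) < s + 1"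
    unfolding ch_Delta_def s_def[symmetric] using s by linarith+
  have "real (p div ch_Delta p) \<le> real p / real (ch_Delta p)" by (rule of_nat_div_le_of_nat)
  also have "\<dots> \<le> real p / s" using D s by (intro divide_left_mono mult_pos_pos) auto
  also have "\<dots> = s" using s by (simp add: field_simps)
  finally show "real_of_int (int (ch_Delta p) + int (p div ch_Delta p) - 1) \<le> 2 * sqrt (real p)"
    using D by (simp add: s_def)
  show "int (ch_Delta p) + int (p div ch_Delta p) - 1 \<ge> 0"
    using ch_Delta_pos[OF assms] by linarith
qed

lemma ch_prime_ge: "ch_prime N \<ge> N"
  using ch_prime_props[of N] ch_overhead_le(1)[of "ch_prime N"] prime_gt_0_nat[of "ch_prime N"] by linarith

text \<open>A prime within \<delta> of ln N + 2 \<delta> on the logarithmic scale lies between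
  exp(\<delta>) N and exp(3 \<delta>) N. The lower end leaves room for the overhead 2 sqrt p, so the
  prime is admissible for N; the upper end bounds p(N).\<close>

lemma ch_prime_le_eventually:
  assumes \<delta>: "\<delta> > 0"
  shows "\<forall>\<^sub>F N in sequentially. real (ch_prime N) \<le> exp (3 * \<delta>) * real N"
proof -
  have lim: "filterlim (\<lambda>N. ln (real N) + 2 * \<delta>) at_top sequentially" by real_asymp
  have "\<forall>\<^sub>F N in sequentially. \<exists>p :: nat. prime p \<and> \<bar>ln (real p) - (ln (real N) + 2 * \<delta>)\<bar> < \<delta>"
    by (rule eventually_compose_filterlim[OF eventually_prime_near[OF \<delta>] lim])
  moreover have "\<forall>\<^sub>F N in sequentially. real N + 2 * (exp (3 * \<delta> / 2) * sqrt (real N)) \<le> exp \<delta> * real N"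
    using \<delta> by real_asymp
  ultimately show ?thesis using eventually_gt_at_top[of 0]
  proof eventually_elim
    case (elim N)
    then obtain p :: nat where p: "prime p" "\<bar>ln (real p) - (ln (real N) + 2 * \<delta>)\<bar> < \<delta>" by blast
    have p0: "p > 0" using prime_gt_0_nat[OF p(1)] .
    have "exp (ln (real p)) \<le> exp (3 * \<delta> + ln (real N))" "exp (\<delta> + ln (real N)) \<le> exp (ln (real p))"
      using p(2) by (simp_all only: exp_le_cancel_iff)
    then have bounds: "real p \<le> exp (3 * \<delta>) * real N" "exp \<delta> * real N \<le> real p"
      using p0 elim(3) by (simp_all add: exp_add)
    have "sqrt (real p) \<le> sqrt (exp (3 * \<delta>) * real N)" using bounds(1) by (rule real_sqrt_le_mono)
    also have "\<dots> = exp (3 * \<delta> / 2) * sqrt (real N)"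
    proof -
      have "exp (3 * \<delta>) = (exp (3 * \<delta> / 2))\<^sup>2" by (simp add: power2_eq_square flip: exp_add)
      then show ?thesis by (simp add: real_sqrt_mult)
    qed
    finally have "real N + 2 * sqrt (real p) \<le> real p" using elim(2) bounds(2) by linarith
    then have "int p - (int (ch_Delta p) + int (p div ch_Delta p) - 1) \<ge> int N"
      using ch_overhead_le(2)[OF p0] by linarith
    with p(1) have "ch_prime N \<le> p" unfolding ch_prime_def by (intro Least_le) simp
    then show ?case using bounds(1) by linarith
  qed
qed

lemma ch_prime_ratio_tendsto: "(\<lambda>N. real (ch_prime N) / real N) \<longlonglongrightarrow> 1"
proof (rule order_tendstoI)
  fix a :: real assume a: "a < 1"
  show "\<forall>\<^sub>F N in sequentially. a < real (ch_prime N) / real N"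
    using eventually_gt_at_top[of 0]
  proof eventually_elim
    case (elim N)
    then have "1 \<le> real (ch_prime N) / real N" using ch_prime_ge[of N] by simp
    then show ?case using a by linarith
  qed
next
  fix a :: real assume a: "1 < a"
  \<comment> \<open>Then exp(3 \<delta>) is the square root of a, strictly below a.\<close>
  define \<delta> where "\<delta> = ln a / 6"
  have \<delta>: "\<delta> > 0" "exp (3 * \<delta>) < a"
  proof -
    have "exp (3 * \<delta>) < exp (ln a)" using a unfolding exp_less_cancel_iff by (simp add: \<delta>_def)
    then show "exp (3 * \<delta>) < a" using a by simp
  qed (use a in \<open>simp add: \<delta>_def\<close>)
  show "\<forall>\<^sub>F N in sequentially. real (ch_prime N) / real N < a"
    using ch_prime_le_eventually[OF \<delta>(1)] eventually_gt_at_top[of 0]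
  proof eventually_elim
    case (elim N)
    then have "real (ch_prime N) / real N \<le> exp (3 * \<delta>)" by (simp add: divide_le_eq)
    then show ?case using \<delta>(2) by linarith
  qed
qed

theorem corollary10:
  "(\<forall>N\<ge>2. \<forall>M b. ideal_matrix (ch_prime N) M \<longrightarrow>
       bij_betw b {0..<card (ch_Dc (ch_prime N))} (ch_Dc (ch_prime N)) \<longrightarrow>
       is_MACH N (2 * (ch_prime N)\<^sup>2) (ideal_ch_seq N (ch_prime N) M b)) \<and>
   (\<lambda>N. 2 * (real (ch_prime N))\<^sup>2 / (real N)\<^sup>2) \<longlonglongrightarrow> 2"
proof (intro conjI allI impI)
  have "(\<lambda>N. 2 * (real (ch_prime N) / real N)\<^sup>2) \<longlonglongrightarrow> 2 * 1\<^sup>2"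
    by (intro tendsto_intros ch_prime_ratio_tendsto)
  then show "(\<lambda>N. 2 * (real (ch_prime N))\<^sup>2 / (real N)\<^sup>2) \<longlonglongrightarrow> 2"
    by (simp add: power_divide)
qed (rule ideal_ch_seq_is_MACH)

end
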